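(* Let $\mathcal H$ and $\mathcal G$ be real Hilbert spaces and let $V\subset\mathcal H$ and $W\subset\mathcal G$ be closed vector subspaces. Let $T\colon\mathcal H\to\mathcal H$ be an $\alpha$-averaged nonexpansive operator for some $\alpha\in\,]0,1[$, let $L\colon\mathcal H\to\mathcal G$ be a bounded linear operator such that $\operatorname{ran}L\subset W$, let $A\colon\mathcal H\rightrightarrows\mathcal H$, $B\colon\mathcal G\rightrightarrows\mathcal G$, and $D\colon\mathcal G\rightrightarrows\mathcal G$ be maximally monotone operators, let $C\colon\mathcal H\to\mathcal H$ be $\beta$-cocoercive for some $\beta\in\,]0,+\infty]$, and suppose that $D$ is $\delta$-strongly monotone for some $\delta\in\,]0,+\infty]$. Consider the problem $$\text{find }(x,u)\in (V\cap\operatorname{Fix}T)\times W\ \text{ such that }\ \begin{cases}0\in Ax+Cx+L^*u+N_Vx\\ 0\in B^{-1}u+D^{-1}u-Lx,\end{cases}\qquad(\mathcal I)$$ and assume that $(\mathcal I)$ admits solutions. Let $\tau\in\,]0,2\beta[$ and $\gamma\in\,]0,2\delta[$ be such that $$\|L\|^2<\left(\frac1\tau-\frac1{2\beta}\right)\left(\frac1\gamma-\frac1{2\delta}\right).$$ Let $x^0\in V$, $\overline x^0=x^0$, $y^0\in V^\perp$, $u^0\in\mathcal G$, and let the sequences be generated, for every $k\in\mathbb N$, by $$\begin{aligned} \eta^{k+1}&=J_{\gamma B^{-1}}\big(u^k+\gamma(L\overline x^k-D^{-1}u^k)\big)\\ u^{k+1}&=P_W\eta^{k+1}\\ w^{k+1}&=J_{\tau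 A}\big(x^k+\tau y^k-\tau P_V(L^*u^{k+1}+Cx^k)\big)\\ r^{k+1}&=P_Vw^{k+1}\\ x^{k+1}&=P_VTr^{k+1}\\ y^{k+1}&=y^k+(r^{k+1}-w^{k+1})/\tau\\ \overline x^{k+1}&=x^{k+1}+r^{k+1}-x^k. \end{aligned}$$ Then $\big((x^k,u^k)\big)_{k\in\mathbb N}$ converges weakly to a solution $(\widehat x,\widehat u)$ of $(\mathcal I)$.
   Context: Notation and conventions. $\operatorname{Fix}T$ is the set of fixed points of $T$; $\operatorname{ran}L$ is the range of $L$; $L^*$ is the adjoint of $L$; $P_S$ is the orthogonal projection onto a closed vector subspace $S$; $N_V$ is the normal cone to $V$, i.e. $N_Vx=V^\perp$ if $x\in V$ and $N_Vx=\varnothing$ otherwise. For a set-valued operator $A\colon\mathcal H\rightrightarrows\mathcal H$, $\operatorname{gra}A$ is its graph, $A^{-1}\colon u\mapsto\{x\in\mathcal H: u\in Ax\}$ is its inverse, and $J_A=(\mathrm{Id}+A)^{-1}$ is its resolvent, where $\mathrm{Id}$ is the identity operator. $A$ is $\rho$-strongly monotone ($\rho\ge0$) if $\langle x-y\mid u-v\rangle\ge\rho\|x-y\|^2$ for all $(x,u),(y,v)\in\operatorname{gra}A$; it is monotone if it is $0$-strongly monotone; it is maximally monotone if it is monotone and no monotone operator has a graph strictly containing $\operatorname{gra}A$. $T\colon\mathcal H\to\mathcal H$ is $\alpha$-averaged nonexpansive, $\alpha\in\,]0,1[$, if for all $x,y\in\mathcal H$, $\|Tx-Ty\|^2\le\|x-y\|^2-\frac{1-\alpha}{\alpha}\|(\mathrm{Id}-T)x-(\mathrm{Id}-T)y\|^2$.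 $C\colon\mathcal H\to\mathcal H$ is $\beta$-cocoercive, $\beta>0$, if for all $x,y\in\mathcal H$, $\langle x-y\mid Cx-Cy\rangle\ge\beta\|Cx-Cy\|^2$. Since $D$ is maximally monotone and $\delta$-strongly monotone with $\delta>0$, $D^{-1}$ is single-valued and defined on all of $\mathcal G$, and $D^{-1}u$ in the algorithm denotes its value. Infinite constants: the inequalities are read with $0\cdot(+\infty)=0$, so that $\beta=+\infty$ means that $C$ is constant, and $\delta=+\infty$ means that the domain of $D$ is a singleton (so $D^{-1}$ is constant); in these cases $1/(2\beta)=0$, respectively $1/(2\delta)=0$, and $]0,2\beta[$, respectively $]0,2\delta[$, is $]0,+\infty[$. *)

theory Defs
  imports "HOL-Analysis.Analysis"
begin

text \<open>Set-valued operators on a space are functions into sets.  Sums of sets, as in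
  \<open>A x + B x\<close>, are the Minkowski sums of \<open>HOL-Library.Set_Algebras\<close>.\<close>

definition gra :: "('a \<Rightarrow> 'b set) \<Rightarrow> ('a \<times> 'b) set" where
  "gra A = {(x, u). u \<in> A x}"

definition op_inverse :: "('a \<Rightarrow> 'b set) \<Rightarrow> 'b \<Rightarrow> 'a set" where
  "op_inverse A u = {x. u \<in> A x}"

definition op_scale :: "real \<Rightarrow> ('a \<Rightarrow> 'b::real_vector set) \<Rightarrow> 'a \<Rightarrow> 'b set" where
  "op_scale c A x = (\<lambda>u. c *\<^sub>R u) ` A x"

definition resolvent :: "('a::ab_group_add \<Rightarrow> 'a set) \<Rightarrow> 'a \<Rightarrow> 'a set" where
  "resolvent A = op_inverse (\<lambda>x. {x} + A x)"

text \<open>The value of a set-valued operator at a point where it is single-valued (unspecified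
  elsewhere).  It is only applied to resolvents of maximally monotone operators and to the inverse
  of a maximally and strongly monotone one, which are single-valued with full domain.\<close>

definition op_value :: "('a \<Rightarrow> 'b set) \<Rightarrow> 'a \<Rightarrow> 'b" where
  "op_value A x = the_elem (A x)"

text \<open>The constants below are extended reals; multiplication there satisfies \<open>0 * \<infinity> = 0\<close>, so that
  \<open>\<infinity>\<close>-strong monotonicity means that the domain has at most one point, and \<open>\<infinity>\<close>-cocoercivity
  means constancy.\<close>

definition strongly_monotone_op :: "ereal \<Rightarrow> ('a::real_inner \<Rightarrow> 'a set) \<Rightarrow> bool" where
  "strongly_monotone_op \<rho> A \<longleftrightarrow>
     (\<forall>(x, u) \<in> gra A. \<forall>(y, v) \<in> gra A.
        \<rho> * ereal ((norm (x - y))\<^sup>2) \<le> ereal ((x - y) \<bullet> (u - v)))"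

definition monotone_op :: "('a::real_inner \<Rightarrow> 'a set) \<Rightarrow> bool" where
  "monotone_op A \<longleftrightarrow> strongly_monotone_op 0 A"

definition maximally_monotone_op :: "('a::real_inner \<Rightarrow> 'a set) \<Rightarrow> bool" where
  "maximally_monotone_op A \<longleftrightarrow> monotone_op A \<and> (\<nexists>A'. monotone_op A' \<and> gra A \<subset> gra A')"

definition averaged_nonexpansive :: "real \<Rightarrow> ('a::real_inner \<Rightarrow> 'a) \<Rightarrow> bool" where
  "averaged_nonexpansive \<alpha> T \<longleftrightarrow>
     (\<forall>x y. (norm (T x - T y))\<^sup>2 \<le>
        (norm (x - y))\<^sup>2 - (1 - \<alpha>) / \<alpha> * (norm ((x - T x) - (y - T y)))\<^sup>2)"

definition cocoercive :: "ereal \<Rightarrow> ('a::real_inner \<Rightarrow> 'a) \<Rightarrow> bool" where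
  "cocoercive \<beta> C \<longleftrightarrow>
     (\<forall>x y. \<beta> * ereal ((norm (C x - C y))\<^sup>2) \<le> ereal ((x - y) \<bullet> (C x - C y)))"

definition Fix :: "('a \<Rightarrow> 'a) \<Rightarrow> 'a set" where
  "Fix T = {x. T x = x}"

text \<open>The library's \<open>closest_point\<close> is restricted to Heine-Borel spaces, hence to finite
  dimension.\<close>

definition ortho_proj :: "'a::real_inner set \<Rightarrow> 'a \<Rightarrow> 'a" where
  "ortho_proj S x = (THE p. p \<in> S \<and> x - p \<in> S\<^sup>\<bottom>)"

text \<open>The normal cone to a vector subspace.\<close>

definition normal_cone :: "'a::real_inner set \<Rightarrow> 'a \<Rightarrow> 'a set" where
  "normal_cone V x = (if x \<in> V then V\<^sup>\<bottom> else {})"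

definition weakly_converges :: "(nat \<Rightarrow> 'a::real_normed_vector) \<Rightarrow> 'a \<Rightarrow> bool" where
  "weakly_converges s l \<longleftrightarrow>
     (\<forall>f :: 'a \<Rightarrow> real. bounded_linear f \<longrightarrow> (\<lambda>n. f (s n)) \<longlonglongrightarrow> f l)"

definition solutions ::
  "'h::real_inner set \<Rightarrow> 'g::real_inner set \<Rightarrow> ('h \<Rightarrow> 'h) \<Rightarrow> ('h \<Rightarrow> 'g) \<Rightarrow>
   ('h \<Rightarrow> 'h set) \<Rightarrow> ('g \<Rightarrow> 'g set) \<Rightarrow> ('h \<Rightarrow> 'h) \<Rightarrow> ('g \<Rightarrow> 'g set) \<Rightarrow> ('h \<times> 'g) set" where
  "solutions V W T L A B C D =
     {(x, u) \<in> (V \<inter> Fix T) \<times> W.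
        0 \<in> A x + {C x} + {adjoint L u} + normal_cone V x \<and>
        0 \<in> op_inverse B u + op_inverse D u + {- L x}}"

end

theory Submission
  imports Defs
begin

text \<open>A solution \<open>(x, u)\<close> carries a multiplier \<open>y \<in> V\<^sup>\<bottom>\<close> with
  \<open>y - P\<^sub>V (L\<^sup>* u + C x) \<in> A x\<close>. With \<open>p\<^sup>k = x\<^sup>k - xbar\<^sup>k\<close>, the quantity
  \<open>|x\<^sup>k - x|\<^sup>2 / \<tau> + \<tau> |y\<^sup>k - y|\<^sup>2 + |u\<^sup>k - u|\<^sup>2 / \<gamma> - 2 \<langle>u\<^sup>k - u, L p\<^sup>k\<rangle> + (1 / \<tau> - 1 / (2 \<beta>)) |p\<^sup>k|\<^sup>2\<close>
  is nonnegative and decreasing by the bound on \<open>|L|\<close>, and its decrements dominate all the residuals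
  of the iteration. So the weighted distances to the solutions converge, and it remains (Opial) to
  see that weak cluster points are solutions: \<open>C\<close>, \<open>D\<^sup>-\<^sup>1\<close> and \<open>Id - T\<close> are cocoercive and
  their values converge strongly along the iterates, while in the sum of the monotonicity inequalities of
  \<open>A\<close> and \<open>B\<^sup>-\<^sup>1\<close> the products of two weakly convergent sequences cancel. Infinite \<open>\<beta>\<close> and
  \<open>\<delta>\<close> are replaced by large finite ones.\<close>

section \<open>Hilbert spaces\<close>

text \<open>The two half-steps do not see the same primal point: the dual one uses
  \<open>L (x k - p k)\<close>, the primal one produces \<open>r (Suc k)\<close>. As
  \<open>x k - p k - r (Suc k) = p (Suc k) - p k\<close>, the mismatch of the coupling terms
  telescopes, except for a product of \<open>\<eta> (Suc k) - u k\<close> with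
  \<open>L (p k)\<close>. This is the origin of the cross term in the energy, and absorbing that
  product is what the step size condition is for. The two factors of that condition are what the
  proximal terms keep of 1/\<tau> and 1/\<gamma> after cocoercivity has taken its share. The
  projections do no harm: orthogonality of \<open>V\<close> and its complement separates the
  estimates of \<open>x\<close> and \<open>y\<close>, and \<open>range L \<subseteq> W\<close> makes
  the coupling blind to the difference between \<open>\<eta>\<close> and \<open>u\<close>. The
  inclusions for A and for the inverse of B cannot be passed to weak limits one at a time, because
  each contains a product of two merely weakly convergent sequences; only their sum can.\<close>

lemma linear_term_nonneg:
  fixes b c :: real
  assumes "\<And>s. 0 < s \<Longrightarrow> s < 1 \<Longrightarrow> 0 \<le> s * b + s\<^sup>2 * c"
  shows "0 \<le> b"
proof (rule tendsto_lowerbound)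
  show "((\<lambda>s. b + s * c) \<longlongrightarrow> b) (at_right 0)"
    by (rule tendsto_eq_intros refl | simp)+
  have "0 \<le> b + s * c" if "0 < s" "s < 1" for s
  proof -
    have "0 \<le> s * (b + s * c)"
      using assms[OF that] by (simp add: algebra_simps power2_eq_square)
    then show ?thesis using that by (simp add: zero_le_mult_iff)
  qed
  then show "\<forall>\<^sub>F s in at_right 0. 0 \<le> b + s * c"
    unfolding eventually_at_right_field by (intro exI[of _ 1]) auto
qed simp

text \<open>Minimizes t + |z|^2 / 2 over K; the conclusion is the first-order optimality condition.
  Pairs (z, t) let K be a graph (Riesz), a translated subspace at height 0 (projection) or an
  epigraph (Minty), so that one existence argument serves all three.\<close>

lemma quadratic_minimizer:
  fixes K :: "('a::{real_inner, complete_space} \<times> real) set"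
  assumes cl: "closed K" and cv: "convex K" and ne: "K \<noteq> {}"
    and bdd: "\<And>z t. (z, t) \<in> K \<Longrightarrow> m \<le> t + (norm z)\<^sup>2 / 2"
  obtains z0 t0 where "(z0, t0) \<in> K" and "\<And>z t. (z, t) \<in> K \<Longrightarrow> t0 \<le> t + z0 \<bullet> (z - z0)"
proof -
  define f where "f q = snd q + (norm (fst q))\<^sup>2 / 2" for q :: "'a \<times> real"
  define I where "I = Inf (f ` K)"
  have bb: "bdd_below (f ` K)"
    using bdd by (auto simp: f_def intro!: bdd_belowI2[of _ m])
  have I_le: "I \<le> f q" if "q \<in> K" for q
    unfolding I_def using bb that by (rule cINF_lower)
  define \<epsilon> where "\<epsilon> n = inverse (real (Suc n))" for n
  have \<epsilon>0: "\<epsilon> \<longlonglongrightarrow> 0" and \<epsilon>_pos: "0 < \<epsilon> n" for n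
    unfolding \<epsilon>_def using LIMSEQ_inverse_real_of_nat by auto
  have "\<exists>q\<in>K. f q < I + \<epsilon> n" for n
  proof -
    have "Inf (f ` K) < I + \<epsilon> n" using \<epsilon>_pos by (simp add: I_def)
    then show ?thesis using ne cInf_lessD[of "f ` K"] by auto
  qed
  then obtain q where qK: "\<And>n. q n \<in> K" and qI: "\<And>n. f (q n) < I + \<epsilon> n"
    by metis
  \<comment> \<open>The exact strong convexity identity. With s = 1/2 it makes minimizing sequences
    Cauchy; for small s it gives the optimality condition.\<close>
  have combine: "f ((1 - s) *\<^sub>R p + s *\<^sub>R p') =
      (1 - s) * f p + s * f p' - s * (1 - s) / 2 * (norm (fst p - fst p'))\<^sup>2" for s p p'
    unfolding f_def power2_norm_eq_inner
    by (simp add: inner_simps inner_commute field_simps)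
  have dist: "(norm (fst (q n) - fst (q k)))\<^sup>2 \<le> 4 * (\<epsilon> n + \<epsilon> k)" for n k
  proof -
    have "(1 - 1/2) *\<^sub>R q n + (1/2) *\<^sub>R q k \<in> K"
      using cv qK by (intro convexD) auto
    from I_le[OF this] show ?thesis
      unfolding combine using qI[of n] qI[of k] by simp
  qed
  have "Cauchy (\<lambda>n. fst (q n))"
  proof (rule CauchyI)
    fix e :: real assume "0 < e"
    then obtain N where N: "\<And>n. N \<le> n \<Longrightarrow> \<epsilon> n < e\<^sup>2 / 8"
      using order_tendstoD(2)[OF \<epsilon>0, of "e\<^sup>2 / 8"] by (auto simp: eventually_sequentially)
    have "norm (fst (q n) - fst (q k)) < e" if "N \<le> n" "N \<le> k" for n k
    proof -
      have "(norm (fst (q n) - fst (q k)))\<^sup>2 < e\<^sup>2"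
        using dist[of n k] N[OF that(1)] N[OF that(2)] by argo
      then show ?thesis by (rule power2_less_imp_less) (use \<open>0 < e\<close> in simp)
    qed
    then show "\<exists>M. \<forall>m\<ge>M. \<forall>n\<ge>M. norm (fst (q m) - fst (q n)) < e" by blast
  qed
  then obtain z0 where z0: "(\<lambda>n. fst (q n)) \<longlonglongrightarrow> z0"
    using Cauchy_convergent_iff convergent_def by blast
  have fI: "(\<lambda>n. f (q n)) \<longlonglongrightarrow> I"
  proof (rule tendsto_sandwich)
    show "\<forall>\<^sub>F n in sequentially. I \<le> f (q n)" using I_le qK by simp
    show "\<forall>\<^sub>F n in sequentially. f (q n) \<le> I + \<epsilon> n"
      using qI by (intro always_eventually allI less_imp_le)
    show "(\<lambda>n. I + \<epsilon> n) \<longlonglongrightarrow> I"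
      using tendsto_add[OF tendsto_const \<epsilon>0, of I] by simp
  qed simp
  \<comment> \<open>Nothing bounds the second components directly: they converge because both the
    values of \<open>f\<close> and the first components do.\<close>
  define t0 where "t0 = I - (norm z0)\<^sup>2 / 2"
  have "(\<lambda>n. f (q n) - (norm (fst (q n)))\<^sup>2 / 2) \<longlonglongrightarrow> t0"
    unfolding t0_def by (intro tendsto_intros fI z0) auto
  then have "(\<lambda>n. (fst (q n), snd (q n))) \<longlonglongrightarrow> (z0, t0)"
    using z0 by (intro tendsto_Pair) (auto simp: f_def)
  then have inK: "(z0, t0) \<in> K"
    using closed_sequentially[OF cl, of q] qK by simp
  have "t0 \<le> t + z0 \<bullet> (z - z0)" if "(z, t) \<in> K" for z t
  proof -
    have "0 \<le> s * (t - t0 + z0 \<bullet> (z - z0)) + s\<^sup>2 * ((norm (z - z0))\<^sup>2 / 2)"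
      if "0 < s" "s < 1" for s
    proof -
      have "(1 - s) *\<^sub>R (z0, t0) + s *\<^sub>R (z, t) \<in> K"
        using cv inK \<open>(z, t) \<in> K\<close> that by (intro convexD) auto
      from I_le[OF this] have "I \<le> (1 - s) * f (z0, t0) + s * f (z, t) -
          s * (1 - s) / 2 * (norm (z0 - z))\<^sup>2"
        unfolding combine by simp
      also have "\<dots> = I + s * (t - t0 + z0 \<bullet> (z - z0)) + s\<^sup>2 * ((norm (z - z0))\<^sup>2 / 2)"
        unfolding f_def t0_def power2_norm_eq_inner
        by (simp add: inner_simps inner_commute field_simps power2_eq_square)
      finally show ?thesis by simp
    qed
    from linear_term_nonneg[OF this] show ?thesis by simp
  qed
  with inK show thesis by (rule that)
qed

text \<open>The representing vector minimizes |z|^2 / 2 - f z. Every direction and its opposite are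
  admissible, so the optimality condition becomes an equality.\<close>

lemma riesz_representation:
  fixes f :: "'a::{real_inner, complete_space} \<Rightarrow> real"
  assumes "bounded_linear f"
  obtains v where "\<And>x. f x = x \<bullet> v"
proof -
  interpret bounded_linear f by fact
  let ?K = "range (\<lambda>z. (z, - f z))"
  have K: "?K = {(z, t). t = - f z}" by auto
  obtain B where B: "\<And>x. norm (f x) \<le> norm x * B" using bounded by blast
  obtain z0 t0 where z0: "(z0, t0) \<in> ?K" "\<And>z t. (z, t) \<in> ?K \<Longrightarrow> t0 \<le> t + z0 \<bullet> (z - z0)"
  proof (rule quadratic_minimizer[of ?K "- B\<^sup>2 / 2"])
    have "closed {q. snd q = - f (fst q)}"
      (is "closed ?M")
      by (intro closed_Collect_eq continuous_intros continuous_on)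
    moreover have "?M = ?K" by (auto simp: K)
    ultimately show "closed ?K" by simp
    show "convex ?K"
      unfolding K by (auto simp: convex_def add scaleR algebra_simps)
    show "- B\<^sup>2 / 2 \<le> t + (norm z)\<^sup>2 / 2" if "(z, t) \<in> ?K" for z t
    proof -
      have "0 \<le> (B - norm z)\<^sup>2" by simp
      then have "norm z * B \<le> B\<^sup>2 / 2 + (norm z)\<^sup>2 / 2"
        by (simp add: power2_eq_square algebra_simps)
      then show ?thesis using B[of z] that by auto
    qed
  qed auto
  have ge: "0 \<le> z0 \<bullet> d - f d" for d
    using z0(2)[of "z0 + d" "- f (z0 + d)"] z0(1) by (auto simp: K add)
  have "f d = d \<bullet> z0" for d
    using ge[of d] ge[of "- d"] by (simp add: neg inner_commute)
  then show thesis by (rule that)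
qed

text \<open>\<open>adjoint\<close> is defined by choice, so its characteristic property holds once
  some adjoint exists, which is Riesz applied to each functional
  \<open>\<lambda>x. L x \<bullet> y\<close>.\<close>

lemma adjoint_bounded_linear:
  fixes L :: "'a::{real_inner, complete_space} \<Rightarrow> 'b::real_inner"
  assumes "bounded_linear L"
  shows "L x \<bullet> y = x \<bullet> adjoint L y"
proof -
  have "\<exists>v. \<forall>x. L x \<bullet> y = x \<bullet> v" for y
  proof -
    have "bounded_linear (\<lambda>x. L x \<bullet> y)"
      using bounded_linear_inner_left_comp[OF assms] .
    then show ?thesis by (metis riesz_representation)
  qed
  then have "\<exists>g. \<forall>x y. L x \<bullet> y = x \<bullet> g y" by metis
  then have "\<forall>x y. L x \<bullet> y = x \<bullet> adjoint L y"
    unfolding adjoint_def by (rule someI_ex)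
  then show ?thesis by blast
qed

section \<open>Orthogonal projection onto a closed subspace\<close>

locale closed_subspace =
  fixes S :: "'a::{real_inner, complete_space} set"
  assumes sub: "subspace S" and cl: "closed S"
begin

abbreviation P where "P \<equiv> ortho_proj S"

lemma proj_exists: "\<exists>p. p \<in> S \<and> x - p \<in> S\<^sup>\<bottom>"
proof -
  \<comment> \<open>The shortest vector z of the translate S - x is orthogonal to S, hence z + x is
    the projection.\<close>
  let ?K = "{(z, t). z + x \<in> S \<and> t = (0::real)}"
  obtain z0 t0 where z0: "(z0, t0) \<in> ?K" "\<And>z t. (z, t) \<in> ?K \<Longrightarrow> t0 \<le> t + z0 \<bullet> (z - z0)"
  proof (rule quadratic_minimizer[of ?K 0])
    have "?K = ((\<lambda>z. z + x) -` S) \<times> {0}" by auto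
    moreover have "closed ((\<lambda>z. z + x) -` S)"
      by (rule closed_vimage[OF cl]) (intro continuous_intros)
    ultimately show "closed ?K" by (simp add: closed_Times)
    have "u *\<^sub>R a + v *\<^sub>R b + x \<in> S" if "a + x \<in> S" "b + x \<in> S" "u + v = 1" for a b u v
    proof -
      have "x = u *\<^sub>R x + v *\<^sub>R x" using that(3) by (metis scaleR_add_left scaleR_one)
      then have "u *\<^sub>R a + v *\<^sub>R b + x = u *\<^sub>R (a + x) + v *\<^sub>R (b + x)"
        by (simp add: algebra_simps)
      then show ?thesis using that sub by (simp add: subspace_add subspace_scale)
    qed
    then show "convex ?K" by (auto simp: convex_def)
    have "(- x, 0) \<in> ?K" using sub by (simp add: subspace_0)
    then show "?K \<noteq> {}" by blast
  qed auto
  have ge: "0 \<le> z0 \<bullet> d" if "d \<in> S" for d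
    using z0(2)[of "z0 + d" 0] z0(1) that sub subspace_add[of S "z0 + x" d]
    by (auto simp: algebra_simps)
  have "z0 \<bullet> d = 0" if "d \<in> S" for d
    using ge[OF that] ge[of "- d"] that sub by (simp add: subspace_neg)
  then have "x - (z0 + x) \<in> S\<^sup>\<bottom>"
    by (simp add: orthogonal_comp_def orthogonal_def inner_commute)
  then show ?thesis using z0(1) by blast
qed

lemma proj_unique:
  assumes "p \<in> S" "x - p \<in> S\<^sup>\<bottom>"
  shows "P x = p"
  unfolding ortho_proj_def
proof (rule the_equality)
  show "p \<in> S \<and> x - p \<in> S\<^sup>\<bottom>" using assms by simp
  fix q assume q: "q \<in> S \<and> x - q \<in> S\<^sup>\<bottom>"
  have "q - p \<in> S" using q assms sub by (simp add: subspace_diff)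
  then have "(q - p) \<bullet> (x - p) = 0" "(q - p) \<bullet> (x - q) = 0"
    using q assms unfolding orthogonal_comp_def orthogonal_def by blast+
  then have "(q - p) \<bullet> (q - p) = 0" by (simp add: inner_simps)
  then show "q = p" by simp
qed

lemma proj_in [simp]: "P x \<in> S" and proj_diff [simp]: "x - P x \<in> S\<^sup>\<bottom>"
  using proj_exists proj_unique by metis+

lemma inner_perp: "s \<in> S \<Longrightarrow> z \<in> S\<^sup>\<bottom> \<Longrightarrow> s \<bullet> z = 0"
  by (auto simp: orthogonal_comp_def orthogonal_def)

lemma proj_inner: "s \<in> S \<Longrightarrow> s \<bullet> P x = s \<bullet> x"
  using inner_perp[OF _ proj_diff, of s x] by (simp add: inner_simps)

lemma proj_selfadjoint: "P x \<bullet> y = x \<bullet> P y"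
  using proj_inner[OF proj_in, of x y] proj_inner[OF proj_in, of y x] by (simp add: inner_commute)

lemma proj_add: "P (x + y) = P x + P y"
proof (rule proj_unique)
  have "x + y - (P x + P y) = (x - P x) + (y - P y)" by simp
  then show "x + y - (P x + P y) \<in> S\<^sup>\<bottom>"
    by (metis proj_diff subspace_add subspace_orthogonal_comp)
qed (simp add: sub subspace_add)

lemma proj_scaleR: "P (c *\<^sub>R x) = c *\<^sub>R P x"
proof (rule proj_unique)
  have "c *\<^sub>R x - c *\<^sub>R P x = c *\<^sub>R (x - P x)" by (simp add: algebra_simps)
  then show "c *\<^sub>R x - c *\<^sub>R P x \<in> S\<^sup>\<bottom>"
    by (metis proj_diff subspace_scale subspace_orthogonal_comp)
qed (simp add: sub subspace_scale)

lemma proj_pythagoras: "s \<in> S \<Longrightarrow> (norm (x - s))\<^sup>2 = (norm (P x - s))\<^sup>2 + (norm (x - P x))\<^sup>2"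
  using inner_perp[OF subspace_diff[OF sub proj_in[of x]] proj_diff[of x], of s]
  unfolding power2_norm_eq_inner by (simp add: inner_simps inner_commute)

lemma proj_norm_le: "norm (P x) \<le> norm x"
proof -
  have "(norm (P x))\<^sup>2 \<le> (norm x)\<^sup>2"
    using proj_pythagoras[of 0 x] sub by (simp add: subspace_0)
  then show ?thesis by (rule power2_le_imp_le) simp
qed

lemma bounded_linear_proj: "bounded_linear P"
  by (rule bounded_linear_intro[of _ 1]) (simp_all add: proj_add proj_scaleR proj_norm_le)

text \<open>Membership in S is thereby tested by inner products, which survive weak limits; this
  puts the weak cluster points into \<open>V\<close> and \<open>W\<close>.\<close>

lemma perp_perp:
  assumes "\<And>z. z \<in> S\<^sup>\<bottom> \<Longrightarrow> x \<bullet> z = 0"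
  shows "x \<in> S"
proof -
  have "(x - P x) \<bullet> (x - P x) = 0"
    using assms[OF proj_diff[of x]] inner_perp[OF proj_in[of x] proj_diff[of x]]
    by (simp add: inner_simps)
  then show ?thesis by (metis eq_iff_diff_eq_0 inner_eq_zero_iff proj_in)
qed

end

section \<open>Weak convergence\<close>

text \<open>A general filter is allowed because cluster points are taken along filters finer than
  \<open>sequentially\<close>. By Riesz, testing with vectors amounts to testing with bounded
  functionals.\<close>

definition weak_tendsto :: "('i \<Rightarrow> 'a::real_inner) \<Rightarrow> 'a \<Rightarrow> 'i filter \<Rightarrow> bool" where
  "weak_tendsto s l F \<longleftrightarrow> (\<forall>h. ((\<lambda>k. s k \<bullet> h) \<longlongrightarrow> l \<bullet> h) F)"

lemma weak_tendstoD: "weak_tendsto s l F \<Longrightarrow> ((\<lambda>k. s k \<bullet> h) \<longlongrightarrow> l \<bullet> h) F"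
  by (simp add: weak_tendsto_def)

lemma weak_tendsto_perturb:
  assumes "weak_tendsto s l F" and "((\<lambda>k. s' k - s k) \<longlongrightarrow> 0) F"
  shows "weak_tendsto s' l F"
  unfolding weak_tendsto_def
proof
  fix h
  have "((\<lambda>k. s k \<bullet> h + (s' k - s k) \<bullet> h) \<longlongrightarrow> l \<bullet> h + 0 \<bullet> h) F"
    using assms by (intro tendsto_intros weak_tendstoD)
  then show "((\<lambda>k. s' k \<bullet> h) \<longlongrightarrow> l \<bullet> h) F" by (simp add: inner_diff_left)
qed

lemma weak_strong_tendsto:
  assumes s: "weak_tendsto s l F" and bdd: "\<And>k. norm (s k) \<le> M" and t: "(t \<longlongrightarrow> t0) F"
  shows "((\<lambda>k. s k \<bullet> t k) \<longlongrightarrow> l \<bullet> t0) F"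
proof -
  have "((\<lambda>k. s k \<bullet> (t k - t0)) \<longlongrightarrow> 0) F"
  proof (rule Lim_null_comparison)
    show "\<forall>\<^sub>F k in F. norm (s k \<bullet> (t k - t0)) \<le> M * norm (t k - t0)"
      using bdd by (intro always_eventually allI)
        (metis Cauchy_Schwarz_ineq2 mult_right_mono norm_ge_zero order_trans real_norm_def)
    show "((\<lambda>k. M * norm (t k - t0)) \<longlongrightarrow> 0) F"
      using tendsto_mult_right_zero[OF tendsto_norm_zero[OF LIM_zero[OF t]]] .
  qed
  from tendsto_add[OF this weak_tendstoD[OF s, of t0]] show ?thesis
    by (simp add: inner_diff_right)
qed

section \<open>Weak compactness and Opial's lemma\<close>

lemma compact_real_box: "compact (PiE UNIV (\<lambda>h::'a. {- m h .. m h :: real}))"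
proof -
  have "compactin (product_topology (\<lambda>_. euclidean) UNIV) (PiE UNIV (\<lambda>h::'a. {- m h .. m h}))"
    by (simp add: compactin_PiE)
  then show ?thesis by (simp add: euclidean_product_topology)
qed

text \<open>Filters replace subsequences here: a cluster filter exists by Tychonoff's theorem in any
  Hilbert space, without separability.\<close>

lemma weak_cluster_filter:
  fixes s :: "'i \<Rightarrow> 'a::{real_inner, complete_space}"
  assumes F: "F \<noteq> bot" and bdd: "\<And>k. norm (s k) \<le> M"
  obtains F' l where "F' \<le> F" "F' \<noteq> bot" "weak_tendsto s l F'"
proof -
  define \<phi> where "\<phi> k = (\<lambda>h. s k \<bullet> h)" for k
  define K where "K = PiE UNIV (\<lambda>h::'a. {- (M * norm h) .. M * norm h})"
  have \<phi>K: "\<phi> k \<in> K" for k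
  proof -
    have "\<bar>s k \<bullet> h\<bar> \<le> M * norm h" for h
      using bdd[of k] by (metis Cauchy_Schwarz_ineq2 mult_right_mono norm_ge_zero order_trans)
    then show ?thesis unfolding K_def \<phi>_def by (auto simp: abs_le_iff minus_le_iff)
  qed
  have "compact K" unfolding K_def by (rule compact_real_box)
  moreover have "eventually (\<lambda>g. g \<in> K) (filtermap \<phi> F)"
    using \<phi>K by (simp add: eventually_filtermap)
  moreover have "filtermap \<phi> F \<noteq> bot" using F by (simp add: filtermap_bot_iff)
  ultimately obtain f where f: "f \<in> K" "inf (nhds f) (filtermap \<phi> F) \<noteq> bot"
    unfolding compact_filter by blast
  \<comment> \<open>Pulling the neighbourhoods of the cluster point \<open>f\<close> back along
    \<open>\<phi>\<close> gives a filter finer than \<open>F\<close> along which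
    \<open>\<phi>\<close> converges to \<open>f\<close> pointwise.\<close>
  define F' where "F' = inf (filtercomap \<phi> (nhds f)) F"
  have "F' \<noteq> bot"
  proof
    assume "F' = bot"
    then have "eventually (\<lambda>_. False) F'" by simp
    then obtain P Q where PQ: "eventually P (nhds f)" "eventually Q F" "\<And>k. P (\<phi> k) \<Longrightarrow> Q k \<Longrightarrow> False"
      unfolding F'_def eventually_inf eventually_filtercomap by blast
    have "eventually (\<lambda>g. \<not> P g) (filtermap \<phi> F)"
      unfolding eventually_filtermap using PQ(2) by eventually_elim (use PQ(3) in blast)
    then have "eventually (\<lambda>_. False) (inf (nhds f) (filtermap \<phi> F))"
      using PQ(1) unfolding eventually_inf by blast
    then show False using f(2) by (simp add: trivial_limit_def)
  qed
  have "filterlim \<phi> (nhds f) F'"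
    unfolding F'_def by (meson filterlim_filtercomap filterlim_mono inf_le1 order_refl)
  then have lim: "((\<lambda>k. s k \<bullet> h) \<longlongrightarrow> f h) F'" for h
  proof -
    have "filterlim (\<lambda>g. g h) (nhds (f h)) (nhds f)"
      unfolding tendsto_def
    proof (intro allI impI)
      fix U :: "real set" assume "open U" "f h \<in> U"
      then have "open ((\<lambda>g. g h) -` U)" "f \<in> (\<lambda>g. g h) -` U"
        by (auto intro!: open_vimage continuous_on_product_coordinates)
      then show "\<forall>\<^sub>F g in nhds f. g h \<in> U"
        unfolding eventually_nhds by blast
    qed
    from filterlim_compose[OF this \<open>filterlim \<phi> (nhds f) F'\<close>]
    show ?thesis by (simp add: \<phi>_def)
  qed
  \<comment> \<open>Linearity and the bound M are inherited from the functionals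
    \<open>\<phi> k\<close> through pointwise limits; Riesz then turns \<open>f\<close> into a
    vector.\<close>
  have "bounded_linear f"
  proof (rule bounded_linear_intro[of _ M])
    show "f (x + y) = f x + f y" for x y
      using tendsto_unique[OF \<open>F' \<noteq> bot\<close> lim[of "x + y"]] tendsto_add[OF lim lim, of x y]
      by (simp add: inner_add_right)
    show "f (c *\<^sub>R x) = c *\<^sub>R f x" for c x
      using tendsto_unique[OF \<open>F' \<noteq> bot\<close> lim[of "c *\<^sub>R x"]] tendsto_mult_left[OF lim, of c x]
      by simp
    show "norm (f x) \<le> norm x * M" for x
      using f(1) unfolding K_def by (auto simp: PiE_iff abs_le_iff minus_le_iff mult.commute)
  qed
  then obtain l where "\<And>h. f h = h \<bullet> l" by (rule riesz_representation) blast
  then have "weak_tendsto s l F'" using lim by (simp add: weak_tendsto_def inner_commute)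
  moreover have "F' \<le> F" by (simp add: F'_def)
  ultimately show thesis using \<open>F' \<noteq> bot\<close> that by blast
qed

text \<open>For two cluster points the difference of the squared distances is affine in
  \<open>z k\<close>, so the inner product of \<open>z k\<close> with \<open>l' - l\<close>
  converges. Its limits along the two filters must agree, which forces
  \<open>l' = l\<close>.\<close>

lemma opial:
  fixes z :: "nat \<Rightarrow> 'a::{real_inner, complete_space}"
  assumes ne: "S \<noteq> {}" and conv: "\<And>s. s \<in> S \<Longrightarrow> convergent (\<lambda>k. (norm (z k - s))\<^sup>2)"
    and cluster: "\<And>F l. F \<le> sequentially \<Longrightarrow> F \<noteq> bot \<Longrightarrow> weak_tendsto z l F \<Longrightarrow> l \<in> S"
  obtains s where "s \<in> S" "weak_tendsto z s sequentially"
proof -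
  obtain s0 where "s0 \<in> S" using ne by blast
  from conv[OF this] have "Bseq (\<lambda>k. (norm (z k - s0))\<^sup>2)" by (rule convergent_imp_Bseq)
  then obtain B where B: "\<And>k. (norm (z k - s0))\<^sup>2 \<le> B" by (auto simp: Bseq_def)
  have bdd: "norm (z k) \<le> sqrt B + norm s0" for k
    using norm_triangle_sub[of "z k" s0] real_le_rsqrt[OF B[of k]] by simp
  obtain F l where F: "F \<le> sequentially" "F \<noteq> bot" "weak_tendsto z l F"
    using weak_cluster_filter[OF sequentially_bot, of z, OF bdd] by blast
  have l: "l \<in> S" using cluster F by blast
  have "weak_tendsto z l sequentially"
    unfolding weak_tendsto_def
  proof (rule allI, rule ccontr)
    fix h assume "\<not> (\<lambda>k. z k \<bullet> h) \<longlonglongrightarrow> l \<bullet> h"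
    then obtain e where e: "0 < e" "\<not> eventually (\<lambda>k. dist (z k \<bullet> h) (l \<bullet> h) < e) sequentially"
      unfolding tendsto_iff by blast
    \<comment> \<open>The indices at which the test with \<open>h\<close> stays away from its
      supposed limit; they are frequent, so this filter is proper and has a weak cluster point of
      its own.\<close>
    define G where "G = inf sequentially (principal {k. \<not> dist (z k \<bullet> h) (l \<bullet> h) < e})"
    have "G \<noteq> bot"
      using e(2) by (simp add: G_def trivial_limit_def eventually_inf_principal)
    then obtain G' l' where G': "G' \<le> G" "G' \<noteq> bot" "weak_tendsto z l' G'"
      using weak_cluster_filter[of G z, OF _ bdd] by blast
    have G'_seq: "G' \<le> sequentially" using G'(1) by (simp add: G_def)
    then have l': "l' \<in> S" using cluster G' by blast
    obtain c where c: "(\<lambda>k. (norm (z k - l))\<^sup>2 - (norm (z k - l'))\<^sup>2) \<longlonglongrightarrow> c"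
      using conv[OF l] conv[OF l'] unfolding convergent_def by (metis tendsto_diff)
    have expand: "(norm (v - l))\<^sup>2 - (norm (v - l'))\<^sup>2 = 2 * (v \<bullet> (l' - l)) + (l \<bullet> l - l' \<bullet> l')" for v
      unfolding power2_norm_eq_inner by (simp add: inner_simps inner_commute)
    have "2 * (l \<bullet> (l' - l)) + (l \<bullet> l - l' \<bullet> l') = c"
      using F c unfolding expand
      by (intro tendsto_unique[OF F(2) _ tendsto_mono[OF F(1) c[unfolded expand]]]
          tendsto_intros weak_tendstoD)
    moreover have "2 * (l' \<bullet> (l' - l)) + (l \<bullet> l - l' \<bullet> l') = c"
      using G' c unfolding expand
      by (intro tendsto_unique[OF G'(2) _ tendsto_mono[OF G'_seq c[unfolded expand]]]
          tendsto_intros weak_tendstoD)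
    ultimately have "(l' - l) \<bullet> (l' - l) = 0" by (simp add: inner_simps)
    then have "l' = l" by simp
    with G'(3) have "((\<lambda>k. z k \<bullet> h) \<longlongrightarrow> l \<bullet> h) G'" by (simp add: weak_tendstoD)
    then have "eventually (\<lambda>k. dist (z k \<bullet> h) (l \<bullet> h) < e) G'" using e(1) by (rule tendstoD)
    moreover have "eventually (\<lambda>k. \<not> dist (z k \<bullet> h) (l \<bullet> h) < e) G'"
      by (rule filter_leD[OF G'(1)]) (simp add: G_def eventually_inf_principal)
    ultimately have "eventually (\<lambda>_. False) G'" by eventually_elim simp
    then show False using G'(2) by (simp add: trivial_limit_def)
  qed
  with l show thesis by (rule that)
qed

lemma weak_tendsto_Pair:
  "weak_tendsto (\<lambda>k. (s k, t k)) (a, b) F \<longleftrightarrow> weak_tendsto s a F \<and> weak_tendsto t b F"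
proof (intro iffI conjI)
  assume *: "weak_tendsto (\<lambda>k. (s k, t k)) (a, b) F"
  show "weak_tendsto s a F"
    unfolding weak_tendsto_def using weak_tendstoD[OF *, of "(h, 0)" for h] by simp
  show "weak_tendsto t b F"
    unfolding weak_tendsto_def using weak_tendstoD[OF *, of "(0, h)" for h] by simp
next
  assume "weak_tendsto s a F \<and> weak_tendsto t b F"
  then show "weak_tendsto (\<lambda>k. (s k, t k)) (a, b) F"
    unfolding weak_tendsto_def by (auto intro!: tendsto_add simp: inner_prod_def)
qed

lemma weak_tendsto_scaleR:
  "weak_tendsto s l F \<Longrightarrow> weak_tendsto (\<lambda>k. c *\<^sub>R s k) (c *\<^sub>R l) F"
  by (simp add: weak_tendsto_def tendsto_mult_left)

lemma bounded_perturb: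
  fixes s s' :: "nat \<Rightarrow> 'a::real_normed_vector"
  assumes "\<And>k. norm (s k) \<le> M" and "(\<lambda>k. s' k - s k) \<longlonglongrightarrow> 0"
  obtains M' where "\<And>k. norm (s' k) \<le> M'"
proof -
  have "Bseq (\<lambda>k. s' k - s k)" using assms(2) by (intro convergent_imp_Bseq convergentI)
  then obtain K where K: "\<And>k. norm (s' k - s k) \<le> K" by (auto simp: Bseq_def)
  have "norm (s' k) \<le> M + K" for k
    using norm_triangle_sub[of "s' k" "s k"] assms(1)[of k] K[of k] by linarith
  then show thesis by (rule that)
qed

lemma weak_tendsto_weakly_converges:
  fixes s :: "nat \<Rightarrow> 'a::{real_inner, complete_space}"
  assumes "weak_tendsto s l sequentially"
  shows "weakly_converges s l"
  unfolding weakly_converges_def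
proof (intro allI impI)
  fix f :: "'a \<Rightarrow> real" assume "bounded_linear f"
  then obtain v where "\<And>x. f x = x \<bullet> v" by (rule riesz_representation) blast
  then show "(\<lambda>n. f (s n)) \<longlonglongrightarrow> f l" using weak_tendstoD[OF assms] by simp
qed

section \<open>Maximally monotone and cocoercive operators\<close>

lemma monotone_op_iff:
  "monotone_op A \<longleftrightarrow> (\<forall>x u y v. u \<in> A x \<longrightarrow> v \<in> A y \<longrightarrow> 0 \<le> (x - y) \<bullet> (u - v))"
  by (auto simp: monotone_op_def strongly_monotone_op_def gra_def)

text \<open>Maximality means that the graph contains every point monotonically related to it, since
  such a point could otherwise be adjoined. As an equivalence this transfers to inverses, scalings
  and translations by rewriting.\<close>

lemma maximally_monotone_op_iff:
  "maximally_monotone_op A \<longleftrightarrow>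
     (\<forall>x u. u \<in> A x \<longleftrightarrow> (\<forall>y v. v \<in> A y \<longrightarrow> 0 \<le> (x - y) \<bullet> (u - v)))"
  (is "_ \<longleftrightarrow> ?R")
proof
  assume A: "maximally_monotone_op A"
  then have mono: "0 \<le> (x - y) \<bullet> (u - v)" if "u \<in> A x" "v \<in> A y" for x u y v
    using that by (simp add: maximally_monotone_op_def monotone_op_iff)
  have "u \<in> A x" if *: "\<And>y v. v \<in> A y \<Longrightarrow> 0 \<le> (x - y) \<bullet> (u - v)" for x u
  proof (rule ccontr)
    assume "u \<notin> A x"
    define A' where "A' = A(x := insert u (A x))"
    have "0 \<le> (y - x) \<bullet> (v - u)" if "v \<in> A y" for y v
      using *[OF that] by (simp add: inner_diff inner_commute algebra_simps)
    moreover have "v \<in> A' y \<longleftrightarrow> v \<in> A y \<or> y = x \<and> v = u" for y v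
      by (auto simp: A'_def)
    ultimately have "monotone_op A'"
      unfolding monotone_op_iff using mono * by (metis diff_self inner_zero_left order_refl)
    moreover have "gra A \<subset> gra A'"
      using \<open>u \<notin> A x\<close> by (auto simp: gra_def A'_def split: if_splits)
    ultimately show False using A by (auto simp: maximally_monotone_op_def)
  qed
  with mono show ?R by blast
next
  assume R: ?R
  then have "monotone_op A" unfolding monotone_op_iff by blast
  moreover have False if "monotone_op A'" "gra A \<subset> gra A'" for A'
  proof -
    have sub: "v \<in> A' y" if "v \<in> A y" for v y
      using that \<open>gra A \<subset> gra A'\<close> by (auto simp: gra_def)
    obtain x u where xu: "u \<in> A' x" "u \<notin> A x"
      using \<open>gra A \<subset> gra A'\<close> by (auto simp: gra_def)
    then have "\<forall>y v. v \<in> A y \<longrightarrow> 0 \<le> (x - y) \<bullet> (u - v)"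
      using sub \<open>monotone_op A'\<close> unfolding monotone_op_iff by blast
    then show False using R xu(2) by blast
  qed
  ultimately show "maximally_monotone_op A" by (auto simp: maximally_monotone_op_def)
qed

lemma maximally_monotone_op_mono:
  "maximally_monotone_op A \<Longrightarrow> u \<in> A x \<Longrightarrow> v \<in> A y \<Longrightarrow> 0 \<le> (x - y) \<bullet> (u - v)"
  unfolding maximally_monotone_op_iff by blast

lemma maximally_monotone_op_mem:
  "maximally_monotone_op A \<Longrightarrow> (\<And>y v. v \<in> A y \<Longrightarrow> 0 \<le> (x - y) \<bullet> (u - v)) \<Longrightarrow> u \<in> A x"
  unfolding maximally_monotone_op_iff by blast

lemma maximally_monotone_op_inverse:
  assumes "maximally_monotone_op A"
  shows "maximally_monotone_op (op_inverse A)"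
  using assms unfolding maximally_monotone_op_iff op_inverse_def mem_Collect_eq
  by (metis inner_commute)

lemma mem_op_scale: "c \<noteq> 0 \<Longrightarrow> v \<in> op_scale c A x \<longleftrightarrow> v /\<^sub>R c \<in> A x"
  by (force simp: op_scale_def)

lemma maximally_monotone_op_scale:
  assumes A: "maximally_monotone_op A" and c: "0 < c"
  shows "maximally_monotone_op (op_scale c A)"
  unfolding maximally_monotone_op_iff
proof (intro allI)
  fix x u
  have "u \<in> op_scale c A x \<longleftrightarrow> (\<forall>y v. v \<in> A y \<longrightarrow> 0 \<le> (x - y) \<bullet> (u /\<^sub>R c - v))"
    using A[unfolded maximally_monotone_op_iff, THEN spec, THEN spec, of "u /\<^sub>R c" x] c
    by (subst mem_op_scale) simp_all
  also have "\<dots> \<longleftrightarrow> (\<forall>y v. v \<in> A y \<longrightarrow> 0 \<le> (x - y) \<bullet> (u - c *\<^sub>R v))"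
  proof -
    have "(x - y) \<bullet> (u - c *\<^sub>R v) = c * ((x - y) \<bullet> (u /\<^sub>R c - v))" for y v
      using c by (simp add: inner_diff_right field_simps)
    then show ?thesis using c by (simp add: zero_le_mult_iff)
  qed
  also have "\<dots> \<longleftrightarrow> (\<forall>y v. v \<in> op_scale c A y \<longrightarrow> 0 \<le> (x - y) \<bullet> (u - v))"
    by (auto simp: op_scale_def)
  finally show "u \<in> op_scale c A x \<longleftrightarrow> \<dots>" .
qed

text \<open>The minimizer of \<open>F(x, x*) + (|x|^2 + |x*|^2) / 2\<close>, with \<open>F\<close> the Fitzpatrick function of \<open>A\<close>,
  is \<open>(x, - x)\<close> with \<open>- x \<in> A x\<close>. Since \<open>F\<close> may take the value \<open>\<infinity>\<close>, the minimization takes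
  place over its epigraph \<open>K\<close>.\<close>

lemma minty_zero:
  fixes A :: "'a::{real_inner, complete_space} \<Rightarrow> 'a set"
  assumes A: "maximally_monotone_op A"
  obtains x where "- x \<in> A x"
proof -
  let ?g = "\<lambda>a b (z :: 'a \<times> 'a). fst z \<bullet> b + a \<bullet> snd z - a \<bullet> b"
  \<comment> \<open>The Fitzpatrick function is the supremum of the affine functions
    \<open>?g a b\<close> over the graph, so its epigraph is an intersection of closed
    half-spaces.\<close>
  define K where "K = {q. \<forall>a b. b \<in> A a \<longrightarrow> ?g a b (fst q) \<le> snd q}"
  have mem: "(z, t) \<in> K \<longleftrightarrow> (\<forall>a b. b \<in> A a \<longrightarrow> ?g a b z \<le> t)" for z t
    by (simp add: K_def)
  \<comment> \<open>The graph is nonempty: otherwise (0, 0) would be vacuously related to it, and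
    maximality would put it there.\<close>
  obtain a1 b1 where ab1: "b1 \<in> A a1"
    using maximally_monotone_op_mem[OF A, of 0 0] by blast
  have graphK: "((a, b), a \<bullet> b) \<in> K" if "b \<in> A a" for a b
    unfolding mem
  proof (intro allI impI)
    fix a' b' assume "b' \<in> A a'"
    with that have "0 \<le> (a - a') \<bullet> (b - b')" by (rule maximally_monotone_op_mono[OF A])
    then show "?g a' b' (a, b) \<le> a \<bullet> b" by (simp add: inner_diff)
  qed
  \<comment> \<open>The Fitzpatrick inequality. Off the graph, a graph point that violates
    monotonicity against \<open>(x, v)\<close> supplies an affine function exceeding
    \<open>x \<bullet> v\<close>.\<close>
  have F_ge: "x \<bullet> v \<le> t" if q: "((x, v), t) \<in> K" for x v t
  proof (cases "v \<in> A x")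
    case True
    then have "?g x v (x, v) \<le> t" using q unfolding mem by blast
    then show ?thesis by simp
  next
    case False
    then obtain a b where ab: "b \<in> A a" "\<not> 0 \<le> (x - a) \<bullet> (v - b)"
      using maximally_monotone_op_mem[OF A, of x v] by blast
    then have "x \<bullet> v \<le> ?g a b (x, v)" by (simp add: inner_diff)
    also have "\<dots> \<le> t" using q ab by (simp add: mem)
    finally show ?thesis .
  qed
  obtain z0 t0 where z0: "(z0, t0) \<in> K" and min: "\<And>z t. (z, t) \<in> K \<Longrightarrow> t0 \<le> t + z0 \<bullet> (z - z0)"
  proof (rule quadratic_minimizer[of K 0])
    have "K = (\<Inter>(a, b) \<in> {(a, b). b \<in> A a}. {q. ?g a b (fst q) \<le> snd q})"
      by (auto simp: K_def)
    also have "closed \<dots>"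
      by (intro closed_INT ballI) (auto intro!: closed_Collect_le continuous_intros)
    finally show "closed K" .
    show "convex K"
    proof (rule convexI)
      fix p q :: "('a \<times> 'a) \<times> real" and u v :: real
      assume *: "p \<in> K" "q \<in> K" "0 \<le> u" "0 \<le> v" "u + v = 1"
      have "?g a b (fst (u *\<^sub>R p + v *\<^sub>R q)) \<le> snd (u *\<^sub>R p + v *\<^sub>R q)" if "b \<in> A a" for a b
      proof -
        have "?g a b (fst (u *\<^sub>R p + v *\<^sub>R q)) =
            u * ?g a b (fst p) + v * ?g a b (fst q) + (u + v - 1) * (a \<bullet> b)"
          by (simp add: inner_simps algebra_simps)
        also have "\<dots> \<le> u * snd p + v * snd q"
          using * that by (simp add: K_def add_mono mult_left_mono)
        finally show ?thesis by simp
      qed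
      then show "u *\<^sub>R p + v *\<^sub>R q \<in> K" by (simp add: K_def)
    qed
    show "K \<noteq> {}" using graphK[OF ab1] by blast
    show "0 \<le> t + (norm z)\<^sup>2 / 2" if q: "(z, t) \<in> K" for z t
    proof -
      obtain x v where z: "z = (x, v)" by fastforce
      have "0 \<le> (norm (x + v))\<^sup>2 / 2" by simp
      also have "\<dots> = x \<bullet> v + (norm z)\<^sup>2 / 2"
        unfolding z power2_norm_eq_inner by (simp add: inner_simps inner_commute field_simps)
      also have "\<dots> \<le> t + (norm z)\<^sup>2 / 2" using F_ge q z by simp
      finally show ?thesis .
    qed
  qed blast
  obtain x v where z0_eq: "z0 = (x, v)" by fastforce
  \<comment> \<open>Optimality tested at the points of \<open>K\<close> above the graph, where the
    height is \<open>a \<bullet> b\<close>, together with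
    \<open>x \<bullet> v \<le> t0\<close>.\<close>
  have key: "(norm (x + v))\<^sup>2 \<le> (a + v) \<bullet> (b + x)" if "b \<in> A a" for a b
  proof -
    have "x \<bullet> v \<le> a \<bullet> b + x \<bullet> (a - x) + v \<bullet> (b - v)"
      using min[OF graphK[OF that]] F_ge[of x v t0] z0 by (simp add: z0_eq)
    then show ?thesis
      unfolding power2_norm_eq_inner by (simp add: inner_simps inner_commute)
  qed
  have "- x \<in> A (- v)"
  proof (rule maximally_monotone_op_mem[OF A])
    fix a b assume "b \<in> A a"
    have "0 \<le> (norm (x + v))\<^sup>2" by simp
    also have "\<dots> \<le> (a + v) \<bullet> (b + x)" using key[OF \<open>b \<in> A a\<close>] .
    also have "\<dots> = (- v - a) \<bullet> (- x - b)" by (simp add: inner_simps inner_commute)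
    finally show "0 \<le> (- v - a) \<bullet> (- x - b)" .
  qed
  \<comment> \<open>At \<open>a = - v\<close>, \<open>b = - x\<close> the right side of
    \<open>key\<close> vanishes.\<close>
  moreover from key[OF this] have "v = - x" by (simp add: add_eq_0_iff)
  ultimately show thesis using that by simp
qed

theorem minty:
  fixes A :: "'a::{real_inner, complete_space} \<Rightarrow> 'a set"
  assumes A: "maximally_monotone_op A"
  obtains x where "z - x \<in> A x"
proof -
  \<comment> \<open>Subtracting \<open>z\<close> from all values preserves maximal monotonicity and
    reduces the claim to the case of zero.\<close>
  define A' where "A' x = {v. v + z \<in> A x}" for x
  have "maximally_monotone_op A'"
    unfolding maximally_monotone_op_iff
  proof (intro allI)
    fix x u
    have "u \<in> A' x \<longleftrightarrow> (\<forall>y v. v \<in> A y \<longrightarrow> 0 \<le> (x - y) \<bullet> (u + z - v))"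
      using A[unfolded maximally_monotone_op_iff, THEN spec, THEN spec, of "u + z" x]
      unfolding A'_def mem_Collect_eq .
    also have "\<dots> \<longleftrightarrow> (\<forall>y v. v + z \<in> A y \<longrightarrow> 0 \<le> (x - y) \<bullet> (u + z - (v + z)))"
      by (metis diff_add_cancel)
    finally show "u \<in> A' x \<longleftrightarrow> (\<forall>y v. v \<in> A' y \<longrightarrow> 0 \<le> (x - y) \<bullet> (u - v))"
      by (simp add: A'_def)
  qed
  then obtain x where "- x \<in> A' x" by (rule minty_zero)
  then show thesis using that by (simp add: A'_def)
qed

section \<open>Resolvents and inverses of strongly monotone operators\<close>

lemma mem_resolvent: "x \<in> resolvent A z \<longleftrightarrow> z - x \<in> A x"
  by (force simp: resolvent_def op_inverse_def set_plus_def)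

text \<open>\<open>op_value\<close> is meaningful only on singletons: Minty's theorem gives
  existence, monotonicity gives uniqueness.\<close>

lemma op_value_resolvent:
  fixes A :: "'a::{real_inner, complete_space} \<Rightarrow> 'a set"
  assumes A: "maximally_monotone_op A"
  shows "z - op_value (resolvent A) z \<in> A (op_value (resolvent A) z)"
proof -
  obtain x where x: "z - x \<in> A x" by (rule minty[OF A])
  have "y = x" if "z - y \<in> A y" for y
  proof -
    have "0 \<le> (x - y) \<bullet> (z - x - (z - y))"
      using maximally_monotone_op_mono[OF A x that] .
    also have "\<dots> = - ((x - y) \<bullet> (x - y))" by (simp add: inner_simps)
    finally have "(x - y) \<bullet> (x - y) \<le> 0" by simp
    then have "(x - y) \<bullet> (x - y) = 0" using inner_ge_zero[of "x - y"] by linarith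
    then show ?thesis by simp
  qed
  then have "resolvent A z = {x}" using x mem_resolvent[of _ A z] by blast
  then show ?thesis using x by (simp add: op_value_def)
qed

lemma op_value_resolvent_scale:
  fixes A :: "'a::{real_inner, complete_space} \<Rightarrow> 'a set"
  assumes "maximally_monotone_op A" and "0 < c"
    and "x = op_value (resolvent (op_scale c A)) z"
  shows "(z - x) /\<^sub>R c \<in> A x"
  using op_value_resolvent[OF maximally_monotone_op_scale[OF assms(1,2)], of z] assms(2,3)
  by (simp add: mem_op_scale)

lemma strongly_monotone_op_real:
  "strongly_monotone_op (ereal \<rho>) A \<longleftrightarrow>
     (\<forall>x u y v. u \<in> A x \<longrightarrow> v \<in> A y \<longrightarrow> \<rho> * (norm (x - y))\<^sup>2 \<le> (x - y) \<bullet> (u - v))"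
  by (auto simp: strongly_monotone_op_def gra_def)

text \<open>Subtracting \<rho> times the identity leaves a maximally monotone operator, because the
  term \<rho> |x - y|^2 that is put back has the right sign. Solving for \<open>y\<close> is then a
  resolvent equation for this operator scaled by 1/\<rho>, at the point
  \<open>u /\<^sub>R \<rho>\<close>.\<close>

lemma strongly_monotone_op_surj:
  fixes D :: "'a::{real_inner, complete_space} \<Rightarrow> 'a set"
  assumes D: "maximally_monotone_op D" and \<rho>: "0 < \<rho>" and sm: "strongly_monotone_op (ereal \<rho>) D"
  obtains y where "u \<in> D y"
proof -
  define D' where "D' x = {v. v + \<rho> *\<^sub>R x \<in> D x}" for x
  have "maximally_monotone_op D'"
    unfolding maximally_monotone_op_iff
  proof (intro allI iffI impI)
    fix x u y v assume *: "u \<in> D' x" "v \<in> D' y"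
    then have "\<rho> * (norm (x - y))\<^sup>2 \<le> (x - y) \<bullet> ((u + \<rho> *\<^sub>R x) - (v + \<rho> *\<^sub>R y))"
      using sm unfolding strongly_monotone_op_real D'_def by blast
    then show "0 \<le> (x - y) \<bullet> (u - v)"
      unfolding power2_norm_eq_inner by (simp add: inner_simps algebra_simps)
  next
    fix x u assume *: "\<forall>y v. v \<in> D' y \<longrightarrow> 0 \<le> (x - y) \<bullet> (u - v)"
    have "u + \<rho> *\<^sub>R x \<in> D x"
    proof (rule maximally_monotone_op_mem[OF D])
      fix y v assume "v \<in> D y"
      then have "0 \<le> (x - y) \<bullet> (u - (v - \<rho> *\<^sub>R y))" using * by (simp add: D'_def)
      also have "\<dots> \<le> (x - y) \<bullet> (u - (v - \<rho> *\<^sub>R y)) + \<rho> * ((x - y) \<bullet> (x - y))"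
        using \<rho> by simp
      also have "\<dots> = (x - y) \<bullet> (u + \<rho> *\<^sub>R x - v)" by (simp add: inner_simps algebra_simps)
      finally show "0 \<le> (x - y) \<bullet> (u + \<rho> *\<^sub>R x - v)" .
    qed
    then show "u \<in> D' x" by (simp add: D'_def)
  qed
  from maximally_monotone_op_scale[OF this, of "1 / \<rho>"] \<rho>
  obtain x where "u /\<^sub>R \<rho> - x \<in> op_scale (1 / \<rho>) D' x"
    by (metis minty zero_less_divide_1_iff)
  then have "\<rho> *\<^sub>R (u /\<^sub>R \<rho> - x) \<in> D' x" using \<rho> by (simp add: mem_op_scale)
  then show thesis using that \<rho> by (simp add: D'_def scaleR_diff_right)
qed

lemma op_inverse_strongly_monotone:
  fixes D :: "'a::{real_inner, complete_space} \<Rightarrow> 'a set"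
  assumes D: "maximally_monotone_op D" and \<rho>: "0 < \<rho>" and sm: "strongly_monotone_op (ereal \<rho>) D"
  shows "op_inverse D u = {op_value (op_inverse D) u}"
proof -
  obtain y where y: "u \<in> D y" by (rule strongly_monotone_op_surj[OF assms])
  have "x = y" if "u \<in> D x" for x
  proof -
    have "\<rho> * (norm (x - y))\<^sup>2 \<le> (x - y) \<bullet> (u - u)"
      using sm that y unfolding strongly_monotone_op_real by blast
    then show ?thesis using \<rho> by (simp add: mult_le_0_iff)
  qed
  then have "op_inverse D u = {y}" using y unfolding op_inverse_def by blast
  then show ?thesis by (simp add: op_value_def)
qed

lemma cocoercive_real:
  "cocoercive (ereal \<beta>) C \<longleftrightarrow> (\<forall>x y. \<beta> * (norm (C x - C y))\<^sup>2 \<le> (x - y) \<bullet> (C x - C y))"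
  by (simp add: cocoercive_def)

lemma cocoercive_op_inverse:
  fixes D :: "'a::{real_inner, complete_space} \<Rightarrow> 'a set"
  assumes D: "maximally_monotone_op D" and \<rho>: "0 < \<rho>" and sm: "strongly_monotone_op (ereal \<rho>) D"
  shows "cocoercive (ereal \<rho>) (op_value (op_inverse D))"
  unfolding cocoercive_real
proof (intro allI)
  fix u v
  have "u \<in> D (op_value (op_inverse D) u)" for u
    using op_inverse_strongly_monotone[OF assms, of u] by (auto simp: op_inverse_def)
  then show "\<rho> * (norm (op_value (op_inverse D) u - op_value (op_inverse D) v))\<^sup>2
      \<le> (u - v) \<bullet> (op_value (op_inverse D) u - op_value (op_inverse D) v)"
    using sm unfolding strongly_monotone_op_real by (metis inner_commute)
qed

text \<open>In the cocoercivity inequality between \<open>s k\<close> and \<open>l\<close> one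
  factor converges weakly and the other strongly, so the right side tends to 0 while the left side
  tends to \<beta> |c - C l|^2.\<close>

lemma cocoercive_demiclosed:
  assumes F: "F \<noteq> bot" and \<beta>: "0 < \<beta>" and C: "cocoercive (ereal \<beta>) C"
    and s: "weak_tendsto s l F" and bdd: "\<And>k. norm (s k) \<le> M" and lim: "((\<lambda>k. C (s k)) \<longlongrightarrow> c) F"
  shows "C l = c"
proof -
  have "((\<lambda>k. s k \<bullet> (C (s k) - C l) - l \<bullet> (C (s k) - C l)) \<longlongrightarrow> l \<bullet> (c - C l) - l \<bullet> (c - C l)) F"
    by (intro tendsto_intros weak_strong_tendsto[OF s bdd] lim)
  moreover have "((\<lambda>k. \<beta> * (norm (C (s k) - C l))\<^sup>2) \<longlongrightarrow> \<beta> * (norm (c - C l))\<^sup>2) F"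
    by (intro tendsto_intros lim)
  ultimately have "\<beta> * (norm (c - C l))\<^sup>2 \<le> l \<bullet> (c - C l) - l \<bullet> (c - C l)"
    by (rule tendsto_le[OF F]) (use C in \<open>simp add: cocoercive_real inner_diff_left\<close>)
  then show ?thesis using \<beta> by (simp add: mult_le_0_iff)
qed

text \<open>Brings fixed points of T under the demiclosedness argument, as zeros of a cocoercive
  operator.\<close>

lemma averaged_nonexpansive_cocoercive:
  assumes T: "averaged_nonexpansive \<alpha> T" and \<alpha>: "0 < \<alpha>"
  shows "cocoercive (ereal (1 / (2 * \<alpha>))) (\<lambda>x. x - T x)"
  unfolding cocoercive_real
proof (intro allI)
  fix x y
  let ?U = "x - T x - (y - T y)"
  have "T x - T y = (x - y) - ?U" by simp
  then have "(norm (T x - T y))\<^sup>2 = (norm (x - y))\<^sup>2 - 2 * ((x - y) \<bullet> ?U) + (norm ?U)\<^sup>2"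
    unfolding power2_norm_eq_inner by (simp only: inner_diff inner_commute) simp
  moreover have "(norm (T x - T y))\<^sup>2 \<le> (norm (x - y))\<^sup>2 - (1 - \<alpha>) / \<alpha> * (norm ?U)\<^sup>2"
    using T unfolding averaged_nonexpansive_def by blast
  moreover have "(1 - \<alpha>) / \<alpha> * (norm ?U)\<^sup>2 = 2 * (1 / (2 * \<alpha>) * (norm ?U)\<^sup>2) - (norm ?U)\<^sup>2"
    using \<alpha> by (simp add: field_simps)
  ultimately show "1 / (2 * \<alpha>) * (norm ?U)\<^sup>2 \<le> (x - y) \<bullet> ?U" by linarith
qed

text \<open>If the first term were negative for some point of the graph of \<open>A\<close>, the second one would be
  positive on the whole graph of \<open>B\<close>, hence \<open>(u, q)\<close> would belong to it: take \<open>(b, b') = (u, q)\<close>.\<close>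

lemma maximally_monotone_op_product:
  assumes A: "maximally_monotone_op A" and B: "maximally_monotone_op B"
    and pos: "\<And>a a' b b'. a' \<in> A a \<Longrightarrow> b' \<in> B b \<Longrightarrow> 0 \<le> (x - a) \<bullet> (v - a') + (u - b) \<bullet> (q - b')"
  shows "v \<in> A x \<and> q \<in> B u"
proof -
  have vA: "v \<in> A x"
  proof (rule ccontr)
    assume "v \<notin> A x"
    then obtain a a' where a: "a' \<in> A a" "(x - a) \<bullet> (v - a') < 0"
      using maximally_monotone_op_mem[OF A, of x v] by (meson not_le)
    have "q \<in> B u"
    proof (rule maximally_monotone_op_mem[OF B])
      fix b b' assume "b' \<in> B b"
      from pos[OF a(1) this] a(2) show "0 \<le> (u - b) \<bullet> (q - b')" by linarith
    qed
    from pos[OF a(1) this] a(2) show False by simp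
  qed
  moreover have "q \<in> B u"
  proof (rule maximally_monotone_op_mem[OF B])
    fix b b' assume "b' \<in> B b"
    from pos[OF vA this] show "0 \<le> (u - b) \<bullet> (q - b')" by simp
  qed
  ultimately show ?thesis by blast
qed

lemma cocoercive_antimono:
  assumes "cocoercive \<beta> C" and "\<beta>' \<le> \<beta>"
  shows "cocoercive \<beta>' C"
  unfolding cocoercive_def
proof (intro allI)
  fix x y
  have "\<beta>' * ereal ((norm (C x - C y))\<^sup>2) \<le> \<beta> * ereal ((norm (C x - C y))\<^sup>2)"
    by (rule ereal_mult_right_mono[OF assms(2)]) simp
  also have "\<dots> \<le> ereal ((x - y) \<bullet> (C x - C y))" using assms(1) by (simp add: cocoercive_def)
  finally show "\<beta>' * ereal ((norm (C x - C y))\<^sup>2) \<le> ereal ((x - y) \<bullet> (C x - C y))" .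
qed

lemma strongly_monotone_op_antimono:
  assumes "strongly_monotone_op \<rho> A" and "\<rho>' \<le> \<rho>"
  shows "strongly_monotone_op \<rho>' A"
  unfolding strongly_monotone_op_def
proof clarify
  fix x u y v assume "(x, u) \<in> gra A" "(y, v) \<in> gra A"
  have "\<rho>' * ereal ((norm (x - y))\<^sup>2) \<le> \<rho> * ereal ((norm (x - y))\<^sup>2)"
    by (rule ereal_mult_right_mono[OF assms(2)]) simp
  also have "\<dots> \<le> ereal ((x - y) \<bullet> (u - v))"
    using assms(1) \<open>(x, u) \<in> gra A\<close> \<open>(y, v) \<in> gra A\<close> by (fastforce simp: strongly_monotone_op_def)
  finally show "\<rho>' * ereal ((norm (x - y))\<^sup>2) \<le> ereal ((x - y) \<bullet> (u - v))" .
qed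

section \<open>The projected primal-dual iteration\<close>

lemma descent:
  fixes E R :: "nat \<Rightarrow> real"
  assumes "\<And>k. E (Suc k) + R k \<le> E k" and "\<And>k. 0 \<le> E k" and R: "\<And>k. 0 \<le> R k"
  shows "convergent E" and "R \<longlonglongrightarrow> 0" and "E k \<le> E 0"
proof -
  have le: "E (Suc k) \<le> E k" for k using assms(1)[of k] R[of k] by linarith
  then have dec: "decseq E" by (simp add: decseq_Suc_iff)
  then show "E k \<le> E 0" by (simp add: decseqD)
  obtain l where l: "E \<longlonglongrightarrow> l" using decseq_convergent[OF dec, of 0] assms(2) by blast
  then show "convergent E" by (rule convergentI)
  show "R \<longlonglongrightarrow> 0"
  proof (rule tendsto_sandwich)
    show "\<forall>\<^sub>F k in sequentially. 0 \<le> R k" using R by simp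
    show "\<forall>\<^sub>F k in sequentially. R k \<le> E k - E (Suc k)"
      using assms(1) by (intro always_eventually allI) (simp add: algebra_simps)
    show "(\<lambda>k. E k - E (Suc k)) \<longlonglongrightarrow> 0"
      using tendsto_diff[OF l LIMSEQ_Suc[OF l]] by simp
  qed simp
qed

lemma tendsto_zero_norm_square:
  fixes v :: "'i \<Rightarrow> 'a::real_normed_vector" and R :: "'i \<Rightarrow> real"
  assumes "(R \<longlongrightarrow> 0) F" and "0 < c" and le: "\<And>k. c * (norm (v k))\<^sup>2 \<le> R k"
  shows "(v \<longlongrightarrow> 0) F"
proof -
  have "((\<lambda>k. (norm (v k))\<^sup>2) \<longlongrightarrow> 0) F"
  proof (rule tendsto_sandwich[of "\<lambda>_. 0"])
    show "\<forall>\<^sub>F k in F. (norm (v k))\<^sup>2 \<le> R k / c"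
      using le \<open>0 < c\<close> by (simp add: field_simps)
    show "((\<lambda>k. R k / c) \<longlongrightarrow> 0) F" using tendsto_divide_zero[OF assms(1)] .
  qed simp_all
  then have "((\<lambda>k. sqrt ((norm (v k))\<^sup>2)) \<longlongrightarrow> sqrt 0) F" by (rule tendsto_real_sqrt)
  then show ?thesis by (simp add: tendsto_norm_zero_iff)
qed

text \<open>The equality \<open>2 \<beta> |d|^2 + 2 \<langle>v, d\<rangle> = |v + 2 \<beta> d|^2 / (2 \<beta>) - |v|^2 / (2 \<beta>)\<close>, with
  \<open>v = z - x\<close> and \<open>d = C x - C y\<close>. Keeping the square makes \<open>C x\<^sup>k\<close> converge strongly.\<close>

lemma cocoercive_shifted:
  assumes "0 < \<beta>" and "cocoercive (ereal \<beta>) C"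
  shows "(norm (z - x + (2 * \<beta>) *\<^sub>R (C x - C y)))\<^sup>2 / (2 * \<beta>) - (norm (z - x))\<^sup>2 / (2 * \<beta>)
    \<le> 2 * ((z - y) \<bullet> (C x - C y))"
proof -
  define v d where "v = z - x" and "d = C x - C y"
  have "(norm (v + (2 * \<beta>) *\<^sub>R d))\<^sup>2 / (2 * \<beta>) - (norm v)\<^sup>2 / (2 * \<beta>) = 2 * (\<beta> * (norm d)\<^sup>2) + 2 * (v \<bullet> d)"
    using assms(1) unfolding power2_norm_eq_inner
    by (simp add: inner_simps inner_commute field_simps)
  also have "\<dots> \<le> 2 * ((x - y) \<bullet> d) + 2 * (v \<bullet> d)"
    using assms(2) by (simp add: cocoercive_real d_def)
  also have "\<dots> = 2 * ((z - y) \<bullet> d)" by (simp add: v_def inner_simps)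
  finally show ?thesis by (simp add: v_def d_def)
qed

text \<open>The iteration in the form used by the estimates: real constants, \<open>J\<close> for
  the inverse of D, resolvents replaced by inclusions, and \<open>x k - p k\<close> for the
  extrapolated point. Thus \<open>p 0 = 0\<close> encodes that it starts at \<open>x 0\<close>, and
  \<open>p (Suc k) = x k - r (Suc k)\<close> is the extrapolation rule.\<close>

locale projected_primal_dual =
  fixes V :: "'h::{real_inner, complete_space} set"
    and W :: "'g::{real_inner, complete_space} set"
    and T :: "'h \<Rightarrow> 'h" and L :: "'h \<Rightarrow> 'g"
    and A :: "'h \<Rightarrow> 'h set" and B :: "'g \<Rightarrow> 'g set" and C :: "'h \<Rightarrow> 'h" and J :: "'g \<Rightarrow> 'g"
    and \<alpha> \<beta> \<delta> \<tau> \<gamma> :: real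
    and x p y w r :: "nat \<Rightarrow> 'h" and u \<eta> :: "nat \<Rightarrow> 'g"
  assumes V: "closed_subspace V" and W: "closed_subspace W"
    and \<alpha>: "0 < \<alpha>" "\<alpha> < 1" and T: "averaged_nonexpansive \<alpha> T"
    and L: "bounded_linear L" and range_L: "range L \<subseteq> W"
    and A: "maximally_monotone_op A" and B: "maximally_monotone_op B"
    and \<beta>: "0 < \<beta>" and C: "cocoercive (ereal \<beta>) C"
    and \<delta>: "0 < \<delta>" and J: "cocoercive (ereal \<delta>) J"
    and \<tau>: "0 < \<tau>" "\<tau> < 2 * \<beta>" and \<gamma>: "0 < \<gamma>" "\<gamma> < 2 * \<delta>"
    and small: "(onorm L)\<^sup>2 < (1 / \<tau> - 1 / (2 * \<beta>)) * (1 / \<gamma> - 1 / (2 * \<delta>))"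
    and x0: "x 0 \<in> V" and p0: "p 0 = 0" and y0: "y 0 \<in> V\<^sup>\<bottom>"
    and dual: "\<And>k. (u k + \<gamma> *\<^sub>R (L (x k - p k) - J (u k)) - \<eta> (Suc k)) /\<^sub>R \<gamma>
                 \<in> op_inverse B (\<eta> (Suc k))"
    and u_Suc: "\<And>k. u (Suc k) = ortho_proj W (\<eta> (Suc k))"
    and primal: "\<And>k. (x k + \<tau> *\<^sub>R y k - \<tau> *\<^sub>R ortho_proj V (adjoint L (u (Suc k)) + C (x k))
                   - w (Suc k)) /\<^sub>R \<tau> \<in> A (w (Suc k))"
    and r_Suc: "\<And>k. r (Suc k) = ortho_proj V (w (Suc k))"
    and x_Suc: "\<And>k. x (Suc k) = ortho_proj V (T (r (Suc k)))"
    and y_Suc: "\<And>k. y (Suc k) = y k + (r (Suc k) - w (Suc k)) /\<^sub>R \<tau>"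
    and p_Suc: "\<And>k. p (Suc k) = x k - r (Suc k)"
begin

sublocale V: closed_subspace V by (rule V)
sublocale W: closed_subspace W by (rule W)

abbreviation PV where "PV \<equiv> ortho_proj V"
abbreviation PW where "PW \<equiv> ortho_proj W"

interpretation L: bounded_linear L by (rule L)

lemma adj: "L a \<bullet> b = a \<bullet> adjoint L b"
  by (rule adjoint_bounded_linear[OF L])

lemma x_in: "x k \<in> V"
  by (cases k) (simp_all add: x0 x_Suc)

lemma r_in: "r (Suc k) \<in> V"
  by (simp add: r_Suc)

lemma u_in: "u (Suc k) \<in> W"
  by (simp add: u_Suc)

lemma w_Suc: "w (Suc k) = r (Suc k) + \<tau> *\<^sub>R (y k - y (Suc k))"
  using \<tau> by (simp add: y_Suc)

lemma y_in: "y k \<in> V\<^sup>\<bottom>"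
proof (induction k)
  case (Suc k)
  have "(w (Suc k) - r (Suc k)) /\<^sub>R \<tau> \<in> V\<^sup>\<bottom>"
    by (simp add: r_Suc subspace_scale subspace_orthogonal_comp)
  then have "y k - (w (Suc k) - r (Suc k)) /\<^sub>R \<tau> \<in> V\<^sup>\<bottom>"
    using Suc subspace_orthogonal_comp subspace_diff by blast
  then show ?case by (simp add: y_Suc algebra_simps)
qed (simp add: y0)

text \<open>Substituting \<open>w_Suc\<close> into the resolvent inclusion replaces the old
  \<open>y k\<close> by the new \<open>y (Suc k)\<close>, and the step by the vector
  \<open>p (Suc k)\<close> in \<open>V\<close>.\<close>

lemma primal': "p (Suc k) /\<^sub>R \<tau> + y (Suc k) - PV (adjoint L (u (Suc k)) + C (x k)) \<in> A (w (Suc k))"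
proof -
  have "(x k + \<tau> *\<^sub>R y k - \<tau> *\<^sub>R PV (adjoint L (u (Suc k)) + C (x k)) - w (Suc k)) /\<^sub>R \<tau>
      = p (Suc k) /\<^sub>R \<tau> + y (Suc k) - PV (adjoint L (u (Suc k)) + C (x k))"
    using \<tau> unfolding w_Suc p_Suc by (simp add: algebra_simps)
  then show ?thesis using primal[of k] by simp
qed

lemma dual': "(u k - \<eta> (Suc k)) /\<^sub>R \<gamma> + L (x k - p k) - J (u k) \<in> op_inverse B (\<eta> (Suc k))"
proof -
  have "(u k + \<gamma> *\<^sub>R (L (x k - p k) - J (u k)) - \<eta> (Suc k)) /\<^sub>R \<gamma>
      = (u k - \<eta> (Suc k)) /\<^sub>R \<gamma> + L (x k - p k) - J (u k)"
    using \<gamma> by (simp add: algebra_simps)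
  then show ?thesis using dual[of k] by simp
qed

text \<open>Each element is a stationary point of the iteration. Since the iteration projects the
  dual and smooth terms onto \<open>V\<close>, the multiplier \<open>yh\<close> carries their
  orthogonal component besides the normal vector.\<close>

definition kkt :: "('h \<times> 'h \<times> 'g) set" where
  "kkt = {(xh, yh, uh). xh \<in> V \<and> T xh = xh \<and> yh \<in> V\<^sup>\<bottom> \<and> uh \<in> W \<and>
     yh - PV (adjoint L uh + C xh) \<in> A xh \<and> L xh - J uh \<in> op_inverse B uh}"

text \<open>\<open>a\<close> and \<open>b\<close> are the coefficients of the squared steps that
  remain once \<open>cocoercive_shifted\<close> has used up 1/(2\<beta>) and 1/(2\<delta>).\<close>

definition a where "a = 1 / \<tau> - 1 / (2 * \<beta>)"
definition b where "b = 1 / \<gamma> - 1 / (2 * \<delta>)"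

lemma a_pos: "0 < a" and b_pos: "0 < b" and b_le: "b \<le> 1 / \<gamma>"
  using \<tau> \<gamma> \<beta> \<delta> by (auto simp: a_def b_def field_simps)

text \<open>Here \<kappa> is the norm of L divided by the square root of \<open>a * b\<close>. The
  step size condition makes it less than 1, and the rest is the inequality of arithmetic and
  geometric means.\<close>

lemma cross_bound:
  obtains \<kappa> where "0 \<le> \<kappa>" "\<kappa> < 1"
    and "\<And>v q. 2 * \<bar>v \<bullet> L q\<bar> \<le> \<kappa> * (a * (norm q)\<^sup>2 + b * (norm v)\<^sup>2)"
proof
  define s where "s = sqrt (a * b)"
  have s: "0 < s" using a_pos b_pos by (simp add: s_def)
  have L_s: "onorm L < s"
    using small real_less_rsqrt by (simp add: s_def a_def b_def)
  show "0 \<le> onorm L / s" "onorm L / s < 1"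
    using s L_s onorm_pos_le[OF L] by auto
  show "2 * \<bar>v \<bullet> L q\<bar> \<le> onorm L / s * (a * (norm q)\<^sup>2 + b * (norm v)\<^sup>2)" for v q
  proof -
    have "\<bar>v \<bullet> L q\<bar> \<le> norm v * norm (L q)" by (rule Cauchy_Schwarz_ineq2)
    also have "\<dots> \<le> norm v * (onorm L * norm q)"
      by (intro mult_left_mono onorm[OF L]) simp
    finally have "2 * \<bar>v \<bullet> L q\<bar> \<le> onorm L / s * (2 * (s * (norm v * norm q)))"
      using s by (simp add: mult_ac)
    also have "2 * (s * (norm v * norm q)) \<le> a * (norm q)\<^sup>2 + b * (norm v)\<^sup>2"
    proof -
      have "0 \<le> (sqrt a * norm q - sqrt b * norm v)\<^sup>2" by simp
      then show ?thesis
        using a_pos b_pos by (simp add: power2_diff power_mult_distrib s_def real_sqrt_mult mult_ac)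
    qed
    then have "onorm L / s * (2 * (s * (norm v * norm q)))
        \<le> onorm L / s * (a * (norm q)\<^sup>2 + b * (norm v)\<^sup>2)"
      using s onorm_pos_le[OF L] by (intro mult_left_mono) auto
    finally show ?thesis .
  qed
qed

text \<open>Twice the monotonicity inequality of A between \<open>w (Suc k)\<close> and
  \<open>xh\<close>. Since \<open>w (Suc k) - xh\<close> splits into \<open>R\<close> in
  \<open>V\<close> and a multiple of \<open>Y\<close> in its complement, the mixed products vanish.
  The products \<open>R \<bullet> Q\<close> and \<open>Y \<bullet> Y'\<close> become differences of
  squares, and the smooth term is bounded by \<open>cocoercive_shifted\<close>.\<close>

lemma primal_estimate:
  assumes "(xh, yh, uh) \<in> kkt"
  shows "0 \<le> ((norm (x k - xh))\<^sup>2 - (norm (r (Suc k) - xh))\<^sup>2) / \<tau> - a * (norm (p (Suc k)))\<^sup>2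
    + \<tau> * ((norm (y k - yh))\<^sup>2 - (norm (y (Suc k) - yh))\<^sup>2 - (norm (y k - y (Suc k)))\<^sup>2)
    - 2 * (L (r (Suc k) - xh) \<bullet> (u (Suc k) - uh))
    - (norm ((2 * \<beta>) *\<^sub>R (C (x k) - C xh) - p (Suc k)))\<^sup>2 / (2 * \<beta>)"
proof -
  have xh: "xh \<in> V" and yh: "yh \<in> V\<^sup>\<bottom>" and Ah: "yh - PV (adjoint L uh + C xh) \<in> A xh"
    using assms by (auto simp: kkt_def)
  define R Q Y Y' where "R = r (Suc k) - xh" and "Q = p (Suc k)"
    and "Y = y k - y (Suc k)" and "Y' = y (Suc k) - yh"
  define D where "D = C (x k) - C xh"
  define U where "U = adjoint L (u (Suc k)) - adjoint L uh"
  have RV: "R \<in> V" and QV: "Q \<in> V" and YV: "Y \<in> V\<^sup>\<bottom>" and Y'V: "Y' \<in> V\<^sup>\<bottom>"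
    unfolding R_def Q_def Y_def Y'_def p_Suc
    using xh yh x_in r_in y_in V.sub subspace_orthogonal_comp by (blast intro: subspace_diff)+
  have "p (Suc k) /\<^sub>R \<tau> + y (Suc k) - PV (adjoint L (u (Suc k)) + C (x k)) - (yh - PV (adjoint L uh + C xh))
      = Q /\<^sub>R \<tau> + Y' - PV (U + D)"
  proof -
    have "PV (adjoint L (u (Suc k)) + C (x k)) = PV (U + D) + PV (adjoint L uh + C xh)"
      unfolding V.proj_add[symmetric] by (simp add: U_def D_def algebra_simps)
    then show ?thesis by (simp add: Q_def Y'_def)
  qed
  moreover have "w (Suc k) - xh = R + \<tau> *\<^sub>R Y" by (simp add: w_Suc R_def Y_def)
  ultimately have "0 \<le> (R + \<tau> *\<^sub>R Y) \<bullet> (Q /\<^sub>R \<tau> + Y' - PV (U + D))"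
    using maximally_monotone_op_mono[OF A primal' Ah, of k] by simp
  also have "\<dots> = (R \<bullet> Q) / \<tau> + \<tau> * (Y \<bullet> Y') - R \<bullet> U - R \<bullet> D"
  proof -
    have "R \<bullet> Y' = 0" "Q \<bullet> Y = 0" "PV (U + D) \<bullet> Y = 0"
      using V.inner_perp RV QV YV Y'V by auto
    moreover have "R \<bullet> PV (U + D) = R \<bullet> (U + D)" by (rule V.proj_inner[OF RV])
    ultimately show ?thesis
      by (simp add: inner_simps inner_commute divide_inverse algebra_simps)
  qed
  finally have "0 \<le> 2 * (R \<bullet> Q) / \<tau> + \<tau> * (2 * (Y \<bullet> Y')) - 2 * (R \<bullet> U) - 2 * (R \<bullet> D)" by simp
  moreover have "R \<bullet> U = L (r (Suc k) - xh) \<bullet> (u (Suc k) - uh)"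
    by (simp add: R_def U_def adj inner_diff_right)
  moreover have "(norm ((2 * \<beta>) *\<^sub>R D - Q))\<^sup>2 / (2 * \<beta>) - (norm Q)\<^sup>2 / (2 * \<beta>) \<le> 2 * (R \<bullet> D)"
    using cocoercive_shifted[OF \<beta> C, of "r (Suc k)" "x k" xh]
    by (simp add: R_def Q_def D_def p_Suc norm_minus_commute algebra_simps)
  moreover have "2 * (R \<bullet> Q) / \<tau> = ((norm (x k - xh))\<^sup>2 - (norm R)\<^sup>2) / \<tau> - (norm Q)\<^sup>2 / \<tau>"
  proof -
    have "x k - xh = R + Q" by (simp add: R_def Q_def p_Suc)
    then have "2 * (R \<bullet> Q) = (norm (x k - xh))\<^sup>2 - (norm R)\<^sup>2 - (norm Q)\<^sup>2"
      unfolding power2_norm_eq_inner by (simp add: inner_simps inner_commute)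
    then show ?thesis by (simp add: diff_divide_distrib)
  qed
  moreover have "2 * (Y \<bullet> Y') = (norm (y k - yh))\<^sup>2 - (norm Y')\<^sup>2 - (norm Y)\<^sup>2"
  proof -
    have "y k - yh = Y + Y'" by (simp add: Y_def Y'_def)
    then show ?thesis unfolding power2_norm_eq_inner by (simp add: inner_simps inner_commute)
  qed
  moreover have "a * (norm Q)\<^sup>2 = (norm Q)\<^sup>2 / \<tau> - (norm Q)\<^sup>2 / (2 * \<beta>)"
    by (simp add: a_def algebra_simps)
  ultimately show ?thesis
    unfolding R_def[symmetric] Q_def[symmetric] Y_def[symmetric] Y'_def[symmetric] D_def[symmetric]
    by simp
qed

text \<open>This is where \<open>range L \<subseteq> W\<close> enters: \<open>\<eta>\<close> may be
  exchanged for its projection \<open>u\<close> in every coupling term.\<close>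

lemma inner_L: "PW v \<bullet> L q = v \<bullet> L q"
  using W.proj_inner[of "L q" v] range_L by (auto simp: inner_commute)

text \<open>The inclusion holds at \<open>\<eta> (Suc k)\<close>, the energy is measured at
  \<open>u (Suc k)\<close>. Pythagoras makes the passage between them an additional decrement, and
  \<open>inner_L\<close> leaves the coupling unchanged.\<close>

lemma dual_estimate:
  assumes "(xh, yh, uh) \<in> kkt"
  shows "0 \<le> ((norm (u k - uh))\<^sup>2 - (norm (u (Suc k) - uh))\<^sup>2 - (norm (\<eta> (Suc k) - u (Suc k)))\<^sup>2) / \<gamma>
    - b * (norm (\<eta> (Suc k) - u k))\<^sup>2
    + 2 * (L (x k - p k - xh) \<bullet> (u (Suc k) - uh))
    - (norm ((2 * \<delta>) *\<^sub>R (J (u k) - J uh) + (\<eta> (Suc k) - u k)))\<^sup>2 / (2 * \<delta>)"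
proof -
  have uh: "uh \<in> W" and Bh: "L xh - J uh \<in> op_inverse B uh"
    using assms by (auto simp: kkt_def)
  define R Q where "R = \<eta> (Suc k) - uh" and "Q = u k - \<eta> (Suc k)"
  define D where "D = J (u k) - J uh"
  have "(u k - \<eta> (Suc k)) /\<^sub>R \<gamma> + L (x k - p k) - J (u k) - (L xh - J uh)
      = Q /\<^sub>R \<gamma> + L (x k - p k - xh) - D"
    by (simp add: Q_def D_def L.diff)
  then have "0 \<le> R \<bullet> (Q /\<^sub>R \<gamma> + L (x k - p k - xh) - D)"
    using maximally_monotone_op_mono[OF maximally_monotone_op_inverse[OF B] dual' Bh, of k]
    by (simp add: R_def)
  also have "\<dots> = (R \<bullet> Q) / \<gamma> + R \<bullet> L (x k - p k - xh) - R \<bullet> D"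
    by (simp add: inner_simps divide_inverse mult.commute)
  finally have "0 \<le> 2 * (R \<bullet> Q) / \<gamma> + 2 * (R \<bullet> L (x k - p k - xh)) - 2 * (R \<bullet> D)" by simp
  moreover have "R \<bullet> L (x k - p k - xh) = L (x k - p k - xh) \<bullet> (u (Suc k) - uh)"
    using inner_L[of "\<eta> (Suc k)" "x k - p k - xh"]
    by (simp add: R_def u_Suc inner_diff inner_commute)
  moreover have "(norm ((2 * \<delta>) *\<^sub>R D + (\<eta> (Suc k) - u k)))\<^sup>2 / (2 * \<delta>) - (norm Q)\<^sup>2 / (2 * \<delta>) \<le> 2 * (R \<bullet> D)"
    using cocoercive_shifted[OF \<delta> J, of "\<eta> (Suc k)" "u k" uh]
    by (simp add: R_def Q_def D_def norm_minus_commute algebra_simps)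
  moreover have "2 * (R \<bullet> Q) / \<gamma> = ((norm (u k - uh))\<^sup>2 - (norm (u (Suc k) - uh))\<^sup>2
      - (norm (\<eta> (Suc k) - u (Suc k)))\<^sup>2) / \<gamma> - (norm Q)\<^sup>2 / \<gamma>"
  proof -
    have "u k - uh = R + Q" by (simp add: R_def Q_def)
    then have "2 * (R \<bullet> Q) = (norm (u k - uh))\<^sup>2 - (norm R)\<^sup>2 - (norm Q)\<^sup>2"
      unfolding power2_norm_eq_inner by (simp add: inner_simps inner_commute)
    moreover have "(norm R)\<^sup>2 = (norm (u (Suc k) - uh))\<^sup>2 + (norm (\<eta> (Suc k) - u (Suc k)))\<^sup>2"
      unfolding R_def u_Suc by (rule W.proj_pythagoras[OF uh])
    ultimately show ?thesis by (simp add: diff_divide_distrib add_divide_distrib)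
  qed
  moreover have "norm (\<eta> (Suc k) - u k) = norm Q" by (simp add: Q_def norm_minus_commute)
  moreover have "b * (norm Q)\<^sup>2 = (norm Q)\<^sup>2 / \<gamma> - (norm Q)\<^sup>2 / (2 * \<delta>)"
    by (simp add: b_def algebra_simps)
  ultimately show ?thesis
    unfolding D_def[symmetric] by simp
qed

lemma x_estimate:
  assumes "(xh, yh, uh) \<in> kkt"
  shows "(norm (x (Suc k) - xh))\<^sup>2
    \<le> (norm (r (Suc k) - xh))\<^sup>2 - (1 - \<alpha>) / \<alpha> * (norm (r (Suc k) - T (r (Suc k))))\<^sup>2"
proof -
  have xh: "xh \<in> V" "T xh = xh" using assms by (auto simp: kkt_def)
  have "(norm (x (Suc k) - xh))\<^sup>2 \<le> (norm (T (r (Suc k)) - xh))\<^sup>2"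
    using V.proj_pythagoras[OF xh(1), of "T (r (Suc k))"] by (simp add: x_Suc)
  also have "\<dots> \<le> (norm (r (Suc k) - xh))\<^sup>2 - (1 - \<alpha>) / \<alpha> * (norm (r (Suc k) - T (r (Suc k))))\<^sup>2"
    using T[unfolded averaged_nonexpansive_def, rule_format, of "r (Suc k)" xh] xh(2) by simp
  finally show ?thesis .
qed

section \<open>Energy decrease and asymptotics\<close>

definition dist2 :: "'h \<times> 'h \<times> 'g \<Rightarrow> nat \<Rightarrow> real" where
  "dist2 = (\<lambda>(xh, yh, uh) k. (norm (x k - xh))\<^sup>2 / \<tau> + \<tau> * (norm (y k - yh))\<^sup>2 + (norm (u k - uh))\<^sup>2 / \<gamma>)"

definition energy :: "'h \<times> 'h \<times> 'g \<Rightarrow> nat \<Rightarrow> real" where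
  "energy s k = dist2 s k - 2 * ((u k - snd (snd s)) \<bullet> L (p k)) + a * (norm (p k))\<^sup>2"

text \<open>The factor \<open>c\<close> will be 1 - \<kappa>, the share of the squared steps not
  spent on the cross term. Each summand is nonnegative, so each tends to 0 by itself.\<close>

definition residual :: "'h \<times> 'h \<times> 'g \<Rightarrow> real \<Rightarrow> nat \<Rightarrow> real" where
  "residual = (\<lambda>(xh, yh, uh) c k. c * a * (norm (p k))\<^sup>2 + c * b * (norm (\<eta> (Suc k) - u k))\<^sup>2
    + \<tau> * (norm (y k - y (Suc k)))\<^sup>2 + 1 / \<gamma> * (norm (\<eta> (Suc k) - u (Suc k)))\<^sup>2
    + (1 - \<alpha>) / \<alpha> / \<tau> * (norm (r (Suc k) - T (r (Suc k))))\<^sup>2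
    + 1 / (2 * \<beta>) * (norm ((2 * \<beta>) *\<^sub>R (C (x k) - C xh) - p (Suc k)))\<^sup>2
    + 1 / (2 * \<delta>) * (norm ((2 * \<delta>) *\<^sub>R (J (u k) - J uh) + (\<eta> (Suc k) - u k)))\<^sup>2)"

text \<open>In the sum of both estimates the coupling leaves \<open>L (p (Suc k)) - L (p k)\<close>
  against \<open>u (Suc k) - uh\<close>. The first part belongs to the new energy. In the second,
  \<open>u (Suc k)\<close> is traded for \<open>u k\<close>, which gives the old energy and an error
  bounded through \<kappa>.\<close>

lemma energy_decrease:
  assumes s: "(xh, yh, uh) \<in> kkt"
    and \<kappa>: "\<And>v q. 2 * \<bar>v \<bullet> L q\<bar> \<le> \<kappa> * (a * (norm q)\<^sup>2 + b * (norm v)\<^sup>2)"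
  shows "energy (xh, yh, uh) (Suc k) + residual (xh, yh, uh) (1 - \<kappa>) k \<le> energy (xh, yh, uh) k"
proof -
  have "2 * (L (x k - p k - xh) \<bullet> (u (Suc k) - uh)) - 2 * (L (r (Suc k) - xh) \<bullet> (u (Suc k) - uh))
      = 2 * ((u (Suc k) - uh) \<bullet> L (p (Suc k))) - 2 * ((u (Suc k) - uh) \<bullet> L (p k))"
    by (simp add: p_Suc L.diff inner_simps inner_commute)
  moreover have "(u (Suc k) - uh) \<bullet> L (p k) = (u k - uh) \<bullet> L (p k) + (\<eta> (Suc k) - u k) \<bullet> L (p k)"
    using inner_L[of "\<eta> (Suc k)" "p k"] by (simp add: u_Suc inner_diff)
  moreover have "- (2 * ((\<eta> (Suc k) - u k) \<bullet> L (p k)))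
      \<le> \<kappa> * (a * (norm (p k))\<^sup>2) + \<kappa> * (b * (norm (\<eta> (Suc k) - u k))\<^sup>2)"
    using \<kappa>[of "\<eta> (Suc k) - u k" "p k"] by (simp add: distrib_left)
  moreover have "(norm (x (Suc k) - xh))\<^sup>2 / \<tau>
    \<le> (norm (r (Suc k) - xh))\<^sup>2 / \<tau> - (1 - \<alpha>) / \<alpha> / \<tau> * (norm (r (Suc k) - T (r (Suc k))))\<^sup>2"
  proof -
    have "X / \<tau> \<le> R / \<tau> - c / \<tau> * M" if "X \<le> R - c * M" for X R c M
      using divide_right_mono[OF that, of \<tau>] \<tau> by (simp add: diff_divide_distrib)
    from this[OF x_estimate[OF s]] show ?thesis .
  qed
  moreover note primal_estimate[OF s, of k] dual_estimate[OF s, of k]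
  ultimately show ?thesis
    unfolding energy_def dist2_def residual_def
    by (simp add: diff_divide_distrib right_diff_distrib left_diff_distrib)
qed

text \<open>The same cross bound, now for \<open>u k - uh\<close> and \<open>p k\<close>: the term
  with \<open>a\<close> in the energy covers one part, and \<open>b \<le> 1 / \<gamma>\<close> lets
  the distance cover the other.\<close>

lemma dist2_le_energy:
  assumes "0 \<le> \<kappa>" "\<kappa> < 1"
    and \<kappa>: "\<And>v q. 2 * \<bar>v \<bullet> L q\<bar> \<le> \<kappa> * (a * (norm q)\<^sup>2 + b * (norm v)\<^sup>2)"
  shows "(1 - \<kappa>) * dist2 s k \<le> energy s k" and "0 \<le> dist2 s k"
proof -
  obtain xh yh uh where s: "s = (xh, yh, uh)" by (cases s) auto
  define X U Q where "X = (norm (x k - xh))\<^sup>2 / \<tau> + \<tau> * (norm (y k - yh))\<^sup>2"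
    and "U = (norm (u k - uh))\<^sup>2" and "Q = a * (norm (p k))\<^sup>2"
  have nn: "0 \<le> X" "0 \<le> U" "0 \<le> Q" using \<tau> a_pos by (simp_all add: X_def U_def Q_def)
  have d: "dist2 s k = X + U / \<gamma>" by (simp add: dist2_def s X_def U_def)
  show "0 \<le> dist2 s k" using nn \<gamma> by (simp add: d)
  have "2 * ((u k - uh) \<bullet> L (p k)) \<le> \<kappa> * (Q + b * U)"
    using \<kappa>[of "u k - uh" "p k"] by (simp add: Q_def U_def)
  also have "\<dots> \<le> \<kappa> * (Q + U / \<gamma>)"
    using mult_right_mono[OF b_le nn(2)] assms(1) by (intro mult_left_mono) auto
  also have "\<dots> \<le> Q + \<kappa> * (U / \<gamma>)"
    using mult_right_mono[of \<kappa> 1 Q] assms nn by (simp add: distrib_left)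
  finally have "dist2 s k - \<kappa> * (U / \<gamma>) \<le> energy s k" by (simp add: energy_def s Q_def)
  moreover have "(1 - \<kappa>) * dist2 s k \<le> dist2 s k - \<kappa> * (U / \<gamma>)"
    using mult_nonneg_nonneg[OF assms(1) nn(1)] by (simp add: d algebra_simps diff_divide_distrib)
  ultimately show "(1 - \<kappa>) * dist2 s k \<le> energy s k" by linarith
qed

lemma asymptotics:
  assumes s: "(xh, yh, uh) \<in> kkt"
  shows "p \<longlonglongrightarrow> 0" and "(\<lambda>k. \<eta> (Suc k) - u k) \<longlonglongrightarrow> 0" and "(\<lambda>k. y k - y (Suc k)) \<longlonglongrightarrow> 0"
    and "(\<lambda>k. \<eta> (Suc k) - u (Suc k)) \<longlonglongrightarrow> 0" and "(\<lambda>k. r (Suc k) - T (r (Suc k))) \<longlonglongrightarrow> 0"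
    and "(\<lambda>k. C (x k)) \<longlonglongrightarrow> C xh" and "(\<lambda>k. J (u k)) \<longlonglongrightarrow> J uh"
    and "convergent (dist2 (xh, yh, uh))"
    and "\<exists>M. \<forall>k. norm (x k) \<le> M \<and> norm (y k) \<le> M \<and> norm (u k) \<le> M"
proof -
  let ?s = "(xh, yh, uh)"
  obtain \<kappa> where \<kappa>: "0 \<le> \<kappa>" "\<kappa> < 1"
    and bound: "\<And>v q. 2 * \<bar>v \<bullet> L q\<bar> \<le> \<kappa> * (a * (norm q)\<^sup>2 + b * (norm v)\<^sup>2)"
    by (rule cross_bound) blast
  note d = dist2_le_energy[OF \<kappa> bound]
  define R where "R = residual ?s (1 - \<kappa>)"
  have E_nn: "0 \<le> energy ?s k" for k
    using d(1)[of ?s k] mult_nonneg_nonneg[OF _ d(2)[of ?s k], of "1 - \<kappa>"] \<kappa> by linarith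
  have pos: "0 < (1 - \<kappa>) * a" "0 < (1 - \<kappa>) * b" "0 < 1 / \<gamma>" "0 < (1 - \<alpha>) / \<alpha> / \<tau>"
    "0 < 1 / (2 * \<beta>)" "0 < 1 / (2 * \<delta>)"
    using \<kappa> a_pos b_pos \<gamma> \<alpha> \<tau> \<beta> \<delta> by simp_all
  note pos_le = pos[THEN less_imp_le] \<tau>(1)[THEN less_imp_le]
  have nn: "0 \<le> c * (norm v)\<^sup>2" if "0 \<le> c" for c :: real and v :: "'b::real_normed_vector"
    using that by simp
  have R_nn: "0 \<le> R k" for k
    unfolding R_def residual_def prod.case by (intro add_nonneg_nonneg nn pos_le)
  have step: "energy ?s (Suc k) + R k \<le> energy ?s k" for k
    unfolding R_def by (rule energy_decrease[OF s bound])
  have E: "convergent (energy ?s)" and R: "R \<longlonglongrightarrow> 0" and E0: "energy ?s k \<le> energy ?s 0" for k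
    using descent[of "energy ?s" R, OF step E_nn R_nn] by blast+
  have R_ge:
    "(1 - \<kappa>) * a * (norm (p k))\<^sup>2 \<le> R k"
    "(1 - \<kappa>) * b * (norm (\<eta> (Suc k) - u k))\<^sup>2 \<le> R k"
    "\<tau> * (norm (y k - y (Suc k)))\<^sup>2 \<le> R k"
    "1 / \<gamma> * (norm (\<eta> (Suc k) - u (Suc k)))\<^sup>2 \<le> R k"
    "(1 - \<alpha>) / \<alpha> / \<tau> * (norm (r (Suc k) - T (r (Suc k))))\<^sup>2 \<le> R k"
    "1 / (2 * \<beta>) * (norm ((2 * \<beta>) *\<^sub>R (C (x k) - C xh) - p (Suc k)))\<^sup>2 \<le> R k"
    "1 / (2 * \<delta>) * (norm ((2 * \<delta>) *\<^sub>R (J (u k) - J uh) + (\<eta> (Suc k) - u k)))\<^sup>2 \<le> R k" for k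
    using nn[OF pos_le(1), of "p k"] nn[OF pos_le(2), of "\<eta> (Suc k) - u k"]
      nn[OF pos_le(7), of "y k - y (Suc k)"] nn[OF pos_le(3), of "\<eta> (Suc k) - u (Suc k)"]
      nn[OF pos_le(4), of "r (Suc k) - T (r (Suc k))"]
      nn[OF pos_le(5), of "(2 * \<beta>) *\<^sub>R (C (x k) - C xh) - p (Suc k)"]
      nn[OF pos_le(6), of "(2 * \<delta>) *\<^sub>R (J (u k) - J uh) + (\<eta> (Suc k) - u k)"]
    unfolding R_def residual_def prod.case by linarith+
  note null = tendsto_zero_norm_square[OF R]
  show p: "p \<longlonglongrightarrow> 0" using null[OF pos(1) R_ge(1)] .
  show eu: "(\<lambda>k. \<eta> (Suc k) - u k) \<longlonglongrightarrow> 0" using null[OF pos(2) R_ge(2)] .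
  show "(\<lambda>k. y k - y (Suc k)) \<longlonglongrightarrow> 0" using null[OF \<tau>(1) R_ge(3)] .
  show "(\<lambda>k. \<eta> (Suc k) - u (Suc k)) \<longlonglongrightarrow> 0" using null[OF pos(3) R_ge(4)] .
  show "(\<lambda>k. r (Suc k) - T (r (Suc k))) \<longlonglongrightarrow> 0" using null[OF pos(4) R_ge(5)] .
  \<comment> \<open>The residual controls a combination of \<open>C (x k) - C xh\<close> with
    \<open>p (Suc k)\<close>; as \<open>p\<close> tends to 0, the first part can be isolated. The
    same is done for \<open>J\<close> below.\<close>
  have "(\<lambda>k. (1 / (2 * \<beta>)) *\<^sub>R (((2 * \<beta>) *\<^sub>R (C (x k) - C xh) - p (Suc k)) + p (Suc k)) + C xh)
      \<longlonglongrightarrow> (1 / (2 * \<beta>)) *\<^sub>R (0 + 0) + C xh"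
    by (intro tendsto_intros null[OF pos(5) R_ge(6)] LIMSEQ_Suc[OF p])
  then show "(\<lambda>k. C (x k)) \<longlonglongrightarrow> C xh" using \<beta> by simp
  have "(\<lambda>k. (1 / (2 * \<delta>)) *\<^sub>R (((2 * \<delta>) *\<^sub>R (J (u k) - J uh) + (\<eta> (Suc k) - u k)) - (\<eta> (Suc k) - u k)) + J uh)
      \<longlonglongrightarrow> (1 / (2 * \<delta>)) *\<^sub>R (0 - 0) + J uh"
    by (intro tendsto_intros null[OF pos(6) R_ge(7)] eu)
  then show "(\<lambda>k. J (u k)) \<longlonglongrightarrow> J uh" using \<delta> by (simp only: add_diff_cancel_right') simp
  define M where "M = energy ?s 0 / (1 - \<kappa>)"
  have dM: "dist2 ?s k \<le> M" for k
    using d(1)[of ?s k] E0[of k] \<kappa> by (simp add: M_def field_simps)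
  have M: "norm (x k) \<le> sqrt (\<tau> * M) + norm xh \<and> norm (y k) \<le> sqrt (M / \<tau>) + norm yh
      \<and> norm (u k) \<le> sqrt (\<gamma> * M) + norm uh" for k
  proof -
    have "0 \<le> (norm (x k - xh))\<^sup>2 / \<tau>" "0 \<le> \<tau> * (norm (y k - yh))\<^sup>2" "0 \<le> (norm (u k - uh))\<^sup>2 / \<gamma>"
      using \<tau> \<gamma> by simp_all
    with dM[of k] have "(norm (x k - xh))\<^sup>2 / \<tau> \<le> M" "\<tau> * (norm (y k - yh))\<^sup>2 \<le> M"
      "(norm (u k - uh))\<^sup>2 / \<gamma> \<le> M"
      unfolding dist2_def prod.case by linarith+
    then have "norm (x k - xh) \<le> sqrt (\<tau> * M)" "norm (y k - yh) \<le> sqrt (M / \<tau>)"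
      "norm (u k - uh) \<le> sqrt (\<gamma> * M)"
      using \<tau>(1) \<gamma>(1) by (auto intro!: real_le_rsqrt simp: field_simps)
    then show ?thesis
      using norm_triangle_sub[of "x k" xh] norm_triangle_sub[of "y k" yh] norm_triangle_sub[of "u k" uh]
      by linarith
  qed
  then show "\<exists>M. \<forall>k. norm (x k) \<le> M \<and> norm (y k) \<le> M \<and> norm (u k) \<le> M"
    by (intro exI[of _ "max (sqrt (\<tau> * M) + norm xh) (max (sqrt (M / \<tau>) + norm yh) (sqrt (\<gamma> * M) + norm uh))"])
      (auto simp: le_max_iff_disj)
  \<comment> \<open>Energy and weighted distance differ by terms that vanish, since \<open>u\<close>
    is bounded and \<open>p\<close> tends to 0; hence convergence of the energy passes to the
    distance.\<close>
  have "(\<lambda>k. 2 * ((u k - uh) \<bullet> L (p k)) - a * (norm (p k))\<^sup>2) \<longlonglongrightarrow> 2 * 0 - a * (norm (0::'h))\<^sup>2"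
  proof (intro tendsto_intros p)
    have "(\<lambda>k. L (p k)) \<longlonglongrightarrow> 0" using L.tendsto_zero[OF p] .
    then show "(\<lambda>k. (u k - uh) \<bullet> L (p k)) \<longlonglongrightarrow> 0"
    proof (rule Lim_null_comparison[rotated, OF tendsto_mult_right_zero[OF tendsto_norm_zero]])
      show "\<forall>\<^sub>F k in sequentially. norm ((u k - uh) \<bullet> L (p k)) \<le> (sqrt (\<gamma> * M) + 2 * norm uh) * norm (L (p k))"
      proof (intro always_eventually allI)
        fix k
        have "norm (u k - uh) \<le> sqrt (\<gamma> * M) + 2 * norm uh"
          using norm_triangle_ineq4[of "u k" uh] M[of k] by linarith
        then show "norm ((u k - uh) \<bullet> L (p k)) \<le> (sqrt (\<gamma> * M) + 2 * norm uh) * norm (L (p k))"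
          by (metis Cauchy_Schwarz_ineq2 mult_right_mono norm_ge_zero order_trans real_norm_def)
      qed
    qed
  qed
  from convergent_add[OF E convergentI[OF this]]
  show "convergent (dist2 ?s)" by (simp add: energy_def)
qed

lemma kkt_cluster:
  assumes F: "F \<le> sequentially" "F \<noteq> bot" and ne: "kkt \<noteq> {}"
    and x: "weak_tendsto x xt F" and y: "weak_tendsto y yt F" and u: "weak_tendsto u ut F"
  shows "(xt, yt, ut) \<in> kkt"
proof -
  obtain xh yh uh where "(xh, yh, uh) \<in> kkt" using ne by auto
  note as = asymptotics[OF this]
  note toF = tendsto_mono[OF F(1)]
  obtain M where M: "\<And>k. norm (x k) \<le> M" "\<And>k. norm (y k) \<le> M" "\<And>k. norm (u k) \<le> M"
    using as(9) by blast

  have rx: "(\<lambda>k. r (Suc k) - x k) \<longlonglongrightarrow> 0"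
    using tendsto_minus[OF LIMSEQ_Suc[OF as(1)]] by (simp add: p_Suc)
  have yy: "(\<lambda>k. y (Suc k) - y k) \<longlonglongrightarrow> 0"
    using tendsto_minus[OF as(3)] by simp
  have wr: "(\<lambda>k. w (Suc k) - r (Suc k)) \<longlonglongrightarrow> 0"
    using tendsto_scaleR[OF tendsto_const as(3), of \<tau>] by (simp add: w_Suc)
  have wx: "(\<lambda>k. w (Suc k) - x k) \<longlonglongrightarrow> 0"
    using tendsto_add[OF wr rx] by simp
  have uu: "(\<lambda>k. u (Suc k) - u k) \<longlonglongrightarrow> 0"
    using tendsto_diff[OF as(2) as(4)] by simp

  have r': "weak_tendsto (\<lambda>k. r (Suc k)) xt F" by (rule weak_tendsto_perturb[OF x toF[OF rx]])
  have w': "weak_tendsto (\<lambda>k. w (Suc k)) xt F" by (rule weak_tendsto_perturb[OF x toF[OF wx]])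
  have y': "weak_tendsto (\<lambda>k. y (Suc k)) yt F" by (rule weak_tendsto_perturb[OF y toF[OF yy]])
  have u': "weak_tendsto (\<lambda>k. u (Suc k)) ut F" by (rule weak_tendsto_perturb[OF u toF[OF uu]])
  have \<eta>': "weak_tendsto (\<lambda>k. \<eta> (Suc k)) ut F" by (rule weak_tendsto_perturb[OF u toF[OF as(2)]])
  obtain Mr where Mr: "\<And>k. norm (r (Suc k)) \<le> Mr" by (rule bounded_perturb[OF M(1) rx]) blast
  obtain Mw where Mw: "\<And>k. norm (w (Suc k)) \<le> Mw" by (rule bounded_perturb[OF M(1) wx]) blast
  obtain M\<eta> where M\<eta>: "\<And>k. norm (\<eta> (Suc k)) \<le> M\<eta>" by (rule bounded_perturb[OF M(3) as(2)]) blast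

  have xtV: "xt \<in> V"
  proof (rule V.perp_perp)
    fix z assume z: "z \<in> V\<^sup>\<bottom>"
    have "((\<lambda>k. x k \<bullet> z) \<longlongrightarrow> 0) F" using V.inner_perp[OF x_in z] by simp
    then show "xt \<bullet> z = 0" using tendsto_unique[OF F(2) weak_tendstoD[OF x, of z]] by blast
  qed
  have utW: "ut \<in> W"
  proof (rule W.perp_perp)
    fix z assume z: "z \<in> W\<^sup>\<bottom>"
    have "((\<lambda>k. u (Suc k) \<bullet> z) \<longlongrightarrow> 0) F" using W.inner_perp[OF u_in z] by simp
    then show "ut \<bullet> z = 0" using tendsto_unique[OF F(2) weak_tendstoD[OF u', of z]] by blast
  qed
  have ytV: "yt \<in> V\<^sup>\<bottom>"
    unfolding orthogonal_comp_def orthogonal_def mem_Collect_eq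
  proof
    fix v assume v: "v \<in> V"
    have "((\<lambda>k. y k \<bullet> v) \<longlongrightarrow> 0) F" using V.inner_perp[OF v y_in] by (simp add: inner_commute)
    then have "yt \<bullet> v = 0" using tendsto_unique[OF F(2) weak_tendstoD[OF y, of v]] by blast
    then show "v \<bullet> yt = 0" by (simp add: inner_commute)
  qed

  \<comment> \<open>Applied along \<open>r (Suc k)\<close>, where the residual of T is known to
    vanish; its weak limit is that of \<open>x k\<close>.\<close>
  have "xt - T xt = 0"
    using averaged_nonexpansive_cocoercive[OF T \<alpha>(1)] \<alpha>(1)
    by (intro cocoercive_demiclosed[OF F(2) _ _ r' Mr toF[OF as(5)]]) simp_all
  then have Txt: "T xt = xt" by simp
  have Cxt: "((\<lambda>k. C (x k)) \<longlongrightarrow> C xt) F"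
    using cocoercive_demiclosed[OF F(2) \<beta> C x M(1) toF[OF as(6)]] toF[OF as(6)] by simp
  have Jut: "((\<lambda>k. J (u k)) \<longlongrightarrow> J ut) F"
    using cocoercive_demiclosed[OF F(2) \<delta> J u M(3) toF[OF as(7)]] toF[OF as(7)] by simp
  have PC: "((\<lambda>k. PV (C (x k))) \<longlongrightarrow> PV (C xt)) F"
    by (rule bounded_linear.tendsto[OF V.bounded_linear_proj Cxt])
  have pF: "(p \<longlongrightarrow> 0) F" and p'F: "((\<lambda>k. p (Suc k)) \<longlongrightarrow> 0) F"
    using toF[OF as(1)] toF[OF LIMSEQ_Suc[OF as(1)]] .

  have "yt - PV (adjoint L ut + C xt) \<in> A xt \<and> L xt - J ut \<in> op_inverse B ut"
  proof (rule maximally_monotone_op_product[OF A maximally_monotone_op_inverse[OF B]])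
    fix a a' b b' assume a: "a' \<in> A a" and b: "b' \<in> op_inverse B b"
    define S where "S k = p (Suc k) /\<^sub>R \<tau> - PV (C (x k)) - a'" for k
    define Z where "Z k = (u k - \<eta> (Suc k)) /\<^sub>R \<gamma> - J (u k) - b'" for k
    \<comment> \<open>The sum of the two monotonicity products, arranged so that every factor that
      converges only weakly meets a strongly convergent or fixed one.\<close>
    define g where "g k = w (Suc k) \<bullet> S k + y (Suc k) \<bullet> (w (Suc k) - r (Suc k)) - a \<bullet> S k
      - y (Suc k) \<bullet> a + u (Suc k) \<bullet> L (PV a) + \<eta> (Suc k) \<bullet> Z k
      + (\<eta> (Suc k) \<bullet> L (p (Suc k) - p k)) - b \<bullet> Z k - x k \<bullet> adjoint L b + b \<bullet> L (p k)" for k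
    have g_nonneg: "0 \<le> g k" for k
    proof -
      have "0 \<le> (w (Suc k) - a) \<bullet> (p (Suc k) /\<^sub>R \<tau> + y (Suc k) - PV (adjoint L (u (Suc k)) + C (x k)) - a')
          + (\<eta> (Suc k) - b) \<bullet> ((u k - \<eta> (Suc k)) /\<^sub>R \<gamma> + L (x k - p k) - J (u k) - b')"
        (is "0 \<le> ?f")
        using maximally_monotone_op_mono[OF A primal' a]
          maximally_monotone_op_mono[OF maximally_monotone_op_inverse[OF B] dual' b]
        by (rule add_nonneg_nonneg)
      also have "?f = (w (Suc k) - a) \<bullet> (S k + y (Suc k) - PV (adjoint L (u (Suc k))))
          + (\<eta> (Suc k) - b) \<bullet> (Z k + L (x k - p k))"
        by (simp add: S_def Z_def V.proj_add algebra_simps)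
      also have "\<dots> = g k"
      proof -
        have "r (Suc k) \<bullet> y (Suc k) = 0" by (rule V.inner_perp[OF r_in y_in])
        \<comment> \<open>The decisive cancellation: moving the projections and the adjoint turns
          the coupling in the A part into the one in the B part, up to
          \<open>\<eta> (Suc k) \<bullet> L (p (Suc k) - p k)\<close>, whose second factor tends to
          0.\<close>
        moreover have "w (Suc k) \<bullet> PV (adjoint L (u (Suc k))) = \<eta> (Suc k) \<bullet> L (r (Suc k))"
          by (simp add: V.proj_selfadjoint[symmetric] r_Suc[symmetric] adj[symmetric] u_Suc inner_L
              inner_commute[of "L _"])
        moreover have "a \<bullet> PV (adjoint L (u (Suc k))) = u (Suc k) \<bullet> L (PV a)"
          by (simp add: V.proj_selfadjoint[symmetric] adj[symmetric] inner_commute)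
        moreover have "b \<bullet> L (x k) = x k \<bullet> adjoint L b" by (simp add: adj[symmetric] inner_commute)
        ultimately show ?thesis
          by (simp add: g_def p_Suc L.diff inner_simps inner_commute[of "y (Suc k)"])
      qed
      finally show ?thesis .
    qed
    have S: "(S \<longlongrightarrow> 0 /\<^sub>R \<tau> - PV (C xt) - a') F"
      unfolding S_def by (intro tendsto_intros p'F PC)
    have Z: "(Z \<longlongrightarrow> - 0 /\<^sub>R \<gamma> - J ut - b') F"
      using tendsto_minus[OF toF[OF as(2)]] unfolding Z_def by (intro tendsto_intros Jut) simp
    have "(g \<longlongrightarrow> xt \<bullet> (0 /\<^sub>R \<tau> - PV (C xt) - a') + yt \<bullet> 0 - a \<bullet> (0 /\<^sub>R \<tau> - PV (C xt) - a')
      - yt \<bullet> a + ut \<bullet> L (PV a) + ut \<bullet> (- 0 /\<^sub>R \<gamma> - J ut - b')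
      + ut \<bullet> L (0 - 0) - b \<bullet> (- 0 /\<^sub>R \<gamma> - J ut - b') - xt \<bullet> adjoint L b + b \<bullet> L 0) F"
      (is "(g \<longlongrightarrow> ?l) F")
    proof -
      obtain My where My: "\<And>k. norm (y (Suc k)) \<le> My" using M(2) by blast
      show ?thesis
        unfolding g_def
        by (intro tendsto_intros weak_strong_tendsto[OF w' Mw S] weak_strong_tendsto[OF \<eta>' M\<eta> Z]
            weak_strong_tendsto[OF y' My toF[OF wr]] weak_strong_tendsto[OF \<eta>' M\<eta>]
            weak_tendstoD[OF y'] weak_tendstoD[OF u'] weak_tendstoD[OF x] S Z L.tendsto pF p'F)
    qed
    then have "0 \<le> ?l" by (rule tendsto_lowerbound[OF _ _ F(2)]) (simp add: g_nonneg)
    also have "?l = (xt - a) \<bullet> (yt - PV (adjoint L ut + C xt) - a') + (ut - b) \<bullet> (L xt - J ut - b')"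
    proof -
      have "xt \<bullet> yt = 0" by (rule V.inner_perp[OF xtV ytV])
      moreover have "xt \<bullet> PV (adjoint L ut) = ut \<bullet> L xt"
        by (simp add: V.proj_inner[OF xtV] adj[symmetric] inner_commute)
      moreover have "a \<bullet> PV (adjoint L ut) = ut \<bullet> L (PV a)"
        by (simp add: V.proj_selfadjoint[symmetric] adj[symmetric] inner_commute)
      moreover have "b \<bullet> L xt = xt \<bullet> adjoint L b" by (simp add: adj[symmetric] inner_commute)
      ultimately show ?thesis
        by (simp add: V.proj_add L.zero inner_simps inner_commute[of yt])
    qed
    finally show "0 \<le> (xt - a) \<bullet> (yt - PV (adjoint L ut + C xt) - a') + (ut - b) \<bullet> (L xt - J ut - b')" .
  qed
  then show ?thesis using xtV utW ytV Txt by (simp add: kkt_def)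
qed

theorem weak_convergence:
  assumes ne: "kkt \<noteq> {}"
  obtains xh yh uh where "(xh, yh, uh) \<in> kkt" "weak_tendsto x xh sequentially"
    "weak_tendsto u uh sequentially"
proof -
  \<comment> \<open>This rescaling turns the weighted distance \<open>dist2\<close> into the norm of
    the product space, where \<open>opial\<close> applies.\<close>
  define c where "c = (\<lambda>(v :: 'h, v' :: 'h, q :: 'g). ((1 / sqrt \<tau>) *\<^sub>R v, sqrt \<tau> *\<^sub>R v', (1 / sqrt \<gamma>) *\<^sub>R q))"
  define z where "z = (\<lambda>k. c (x k, y k, u k))"
  have unscale: "weak_tendsto x (sqrt \<tau> *\<^sub>R l1) F \<and> weak_tendsto y ((1 / sqrt \<tau>) *\<^sub>R l2) F
      \<and> weak_tendsto u (sqrt \<gamma> *\<^sub>R l3) F" if z: "weak_tendsto z (l1, l2, l3) F" for l1 l2 l3 F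
  proof -
    have "weak_tendsto (\<lambda>k. (1 / sqrt \<tau>) *\<^sub>R x k) l1 F" "weak_tendsto (\<lambda>k. sqrt \<tau> *\<^sub>R y k) l2 F"
      "weak_tendsto (\<lambda>k. (1 / sqrt \<gamma>) *\<^sub>R u k) l3 F"
      using z by (simp_all add: z_def c_def weak_tendsto_Pair)
    from this(1)[THEN weak_tendsto_scaleR, of "sqrt \<tau>"] this(2)[THEN weak_tendsto_scaleR, of "1 / sqrt \<tau>"]
      this(3)[THEN weak_tendsto_scaleR, of "sqrt \<gamma>"]
    show ?thesis using \<tau> \<gamma> by simp
  qed
  have c_surj: "c (sqrt \<tau> *\<^sub>R l1, (1 / sqrt \<tau>) *\<^sub>R l2, sqrt \<gamma> *\<^sub>R l3) = (l1, l2, l3)" for l1 l2 l3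
    using \<tau> \<gamma> by (simp add: c_def)
  obtain s where s: "s \<in> c ` kkt" "weak_tendsto z s sequentially"
  proof (rule opial[of "c ` kkt" z])
    show "c ` kkt \<noteq> {}" using ne by simp
    show "convergent (\<lambda>k. (norm (z k - s))\<^sup>2)" if s: "s \<in> c ` kkt" for s
    proof -
      obtain xh yh uh where h: "(xh, yh, uh) \<in> kkt" "s = c (xh, yh, uh)"
        using s by (metis imageE prod_cases3)
      have "z k - s = c (x k - xh, y k - yh, u k - uh)" for k
        by (simp add: z_def h(2) c_def scaleR_diff_right)
      moreover have "(norm (c (v, v', q)))\<^sup>2 = (norm v)\<^sup>2 / \<tau> + \<tau> * (norm v')\<^sup>2 + (norm q)\<^sup>2 / \<gamma>" for v v' q
        using \<tau> \<gamma> by (simp add: c_def norm_Pair power_mult_distrib power_divide)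
      ultimately have "(\<lambda>k. (norm (z k - s))\<^sup>2) = dist2 (xh, yh, uh)"
        by (simp add: dist2_def)
      then show ?thesis using asymptotics(8)[OF h(1)] by simp
    qed
    show "l \<in> c ` kkt" if F: "F \<le> sequentially" "F \<noteq> bot" and l: "weak_tendsto z l F" for F l
    proof -
      obtain l1 l2 l3 where l_eq: "l = (l1, l2, l3)" by (cases l) auto
      have "(sqrt \<tau> *\<^sub>R l1, (1 / sqrt \<tau>) *\<^sub>R l2, sqrt \<gamma> *\<^sub>R l3) \<in> kkt"
        using unscale[OF l[unfolded l_eq]] by (intro kkt_cluster[OF F ne]) auto
      from imageI[OF this, of c] show ?thesis by (simp only: l_eq c_surj)
    qed
  qed blast
  then obtain xh yh uh where h: "(xh, yh, uh) \<in> kkt" "s = c (xh, yh, uh)"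
    by (metis imageE prod_cases3)
  have "weak_tendsto x xh sequentially \<and> weak_tendsto u uh sequentially"
    using unscale[OF s(2)[unfolded h(2) c_def prod.case]] \<tau> \<gamma> by simp
  with h(1) show thesis using that by blast
qed

lemma solutions_eq:
  assumes "\<And>v. op_inverse D v = {J v}"
  shows "solutions V W T L A B C D = {(xh, uh). \<exists>yh. (xh, yh, uh) \<in> kkt}"
proof -
  have primal_iff: "0 \<in> A xh + {C xh} + {adjoint L uh} + normal_cone V xh
      \<longleftrightarrow> (\<exists>yh. yh \<in> V\<^sup>\<bottom> \<and> yh - PV (adjoint L uh + C xh) \<in> A xh)" if "xh \<in> V" for xh uh
  proof -
    let ?q = "adjoint L uh + C xh"
    have perp: "?q - PV ?q \<in> V\<^sup>\<bottom>" by simp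
    note diff = subspace_diff[OF subspace_orthogonal_comp]
    have "0 \<in> A xh + {C xh} + {adjoint L uh} + normal_cone V xh
        \<longleftrightarrow> (\<exists>v n. v \<in> A xh \<and> n \<in> V\<^sup>\<bottom> \<and> v + C xh + adjoint L uh + n = 0)"
      using that by (auto simp: set_plus_def normal_cone_def)
    also have "\<dots> \<longleftrightarrow> (\<exists>n. n \<in> V\<^sup>\<bottom> \<and> - n - ?q \<in> A xh)"
    proof -
      have "v + C xh + adjoint L uh + n = 0 \<longleftrightarrow> v = - n - ?q" for v n
        by (auto simp: algebra_simps eq_neg_iff_add_eq_0)
      then show ?thesis by auto
    qed
    also have "\<dots> \<longleftrightarrow> (\<exists>yh. yh \<in> V\<^sup>\<bottom> \<and> yh - PV ?q \<in> A xh)"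
    proof (intro iffI; elim exE conjE)
      fix n assume "n \<in> V\<^sup>\<bottom>" "- n - ?q \<in> A xh"
      \<comment> \<open>The new multiplier is minus the normal vector, minus the component of
        \<open>?q\<close> orthogonal to \<open>V\<close>. This map is an involution, so the converse
        uses the same formula.\<close>
      moreover have "(0 - n) - (?q - PV ?q) \<in> V\<^sup>\<bottom>"
        by (rule diff[OF diff[OF subspace_0[OF subspace_orthogonal_comp] \<open>n \<in> V\<^sup>\<bottom>\<close>] perp])
      ultimately show "\<exists>yh. yh \<in> V\<^sup>\<bottom> \<and> yh - PV ?q \<in> A xh"
        by (intro exI[of _ "(0 - n) - (?q - PV ?q)"]) simp
    next
      fix yh assume "yh \<in> V\<^sup>\<bottom>" "yh - PV ?q \<in> A xh"
      moreover have "(0 - yh) - (?q - PV ?q) \<in> V\<^sup>\<bottom>"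
        by (rule diff[OF diff[OF subspace_0[OF subspace_orthogonal_comp] \<open>yh \<in> V\<^sup>\<bottom>\<close>] perp])
      ultimately show "\<exists>n. n \<in> V\<^sup>\<bottom> \<and> - n - ?q \<in> A xh"
        by (intro exI[of _ "(0 - yh) - (?q - PV ?q)"]) simp
    qed
    finally show ?thesis .
  qed
  have dual_iff: "0 \<in> op_inverse B uh + op_inverse D uh + {- L xh} \<longleftrightarrow> L xh - J uh \<in> op_inverse B uh" for xh uh
  proof -
    have "0 \<in> op_inverse B uh + op_inverse D uh + {- L xh}
        \<longleftrightarrow> (\<exists>v. v \<in> op_inverse B uh \<and> v + J uh + - L xh = 0)"
      unfolding assms by (auto simp: set_plus_def) metis+
    moreover have "v + J uh + - L xh = 0 \<longleftrightarrow> v = L xh - J uh" for v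
      by (auto simp: algebra_simps)
    ultimately show ?thesis by simp
  qed
  show ?thesis
    unfolding solutions_def kkt_def Fix_def by (auto simp: primal_iff dual_iff)
qed

end

section \<open>Reduction to finite constants\<close>

lemma extended_constant_approx:
  fixes \<beta> :: ereal
  assumes \<beta>: "0 < \<beta>" and \<tau>: "0 < \<tau>" "ereal \<tau> < 2 * \<beta>"
  obtains q where "1 / ereal \<tau> - 1 / (2 * \<beta>) = ereal q" and "0 < q"
    and "\<And>q'. q' < q \<Longrightarrow> \<exists>c>0. ereal c \<le> \<beta> \<and> \<tau> < 2 * c \<and> q' < 1 / \<tau> - 1 / (2 * c)"
proof (cases \<beta>)
  case (real c)
  with assms have c: "0 < c" "\<tau> < 2 * c" by simp_all
  have "1 / ereal \<tau> - 1 / (2 * \<beta>) = ereal (1 / \<tau> - 1 / (2 * c))"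
    using real c \<tau> by (simp add: one_ereal_def)
  moreover have "0 < 1 / \<tau> - 1 / (2 * c)" using c \<tau> by (simp add: field_simps)
  ultimately show thesis using c real by (intro that[of "1 / \<tau> - 1 / (2 * c)"]) auto
next
  case PInf
  have "1 / ereal \<tau> - 1 / (2 * \<beta>) = ereal (1 / \<tau>)"
    using PInf \<tau> by (simp add: one_ereal_def)
  moreover have "\<exists>c>0. ereal c \<le> \<beta> \<and> \<tau> < 2 * c \<and> q' < 1 / \<tau> - 1 / (2 * c)" if "q' < 1 / \<tau>" for q'
  proof -
    \<comment> \<open>\<open>e\<close> is the available gap. The constant \<tau> + 1/e is large
      enough both for \<tau> < 2 c and for 1/(2 c) < e.\<close>
    define e where "e = 1 / \<tau> - q'"
    have e: "0 < e" using that by (simp add: e_def)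
    have "1 / (2 * (\<tau> + 1 / e)) < e"
    proof -
      have "0 < 2 * (\<tau> + 1 / e)" using e \<tau> by (simp add: add_pos_pos)
      moreover have "e * (2 * (\<tau> + 1 / e)) = 2 * (e * \<tau>) + 2"
        using e by (simp add: algebra_simps)
      moreover have "0 < e * \<tau>" using e \<tau> by simp
      ultimately show ?thesis by (simp only: pos_divide_less_eq)
    qed
    then have "q' < 1 / \<tau> - 1 / (2 * (\<tau> + 1 / e))" by (simp add: e_def)
    moreover have "\<tau> < 2 * (\<tau> + 1 / e)" "0 < \<tau> + 1 / e" using e \<tau> by (auto intro!: add_pos_pos)
    ultimately show ?thesis using PInf by (intro exI[of _ "\<tau> + 1 / e"]) auto
  qed
  ultimately show thesis using \<tau> by (intro that[of "1 / \<tau>"]) auto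
qed (use \<beta> in auto)

text \<open>The strict inequality leaves room to shrink both factors a little, and each shrunken
  factor is exceeded by one coming from a finite constant.\<close>

lemma finite_constants:
  fixes \<beta> \<delta> :: ereal
  assumes \<beta>: "0 < \<beta>" "0 < \<tau>" "ereal \<tau> < 2 * \<beta>" and \<delta>: "0 < \<delta>" "0 < \<gamma>" "ereal \<gamma> < 2 * \<delta>"
    and X: "0 \<le> X" "ereal X < (1 / ereal \<tau> - 1 / (2 * \<beta>)) * (1 / ereal \<gamma> - 1 / (2 * \<delta>))"
  obtains c d where "0 < c" "ereal c \<le> \<beta>" "\<tau> < 2 * c" "0 < d" "ereal d \<le> \<delta>" "\<gamma> < 2 * d"
    and "X < (1 / \<tau> - 1 / (2 * c)) * (1 / \<gamma> - 1 / (2 * d))"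
proof -
  obtain q where q: "1 / ereal \<tau> - 1 / (2 * \<beta>) = ereal q" "0 < q"
    and q': "\<And>q'. q' < q \<Longrightarrow> \<exists>c>0. ereal c \<le> \<beta> \<and> \<tau> < 2 * c \<and> q' < 1 / \<tau> - 1 / (2 * c)"
    by (rule extended_constant_approx[OF \<beta>]) blast
  obtain t where t: "1 / ereal \<gamma> - 1 / (2 * \<delta>) = ereal t" "0 < t"
    and t': "\<And>q'. q' < t \<Longrightarrow> \<exists>c>0. ereal c \<le> \<delta> \<and> \<gamma> < 2 * c \<and> q' < 1 / \<gamma> - 1 / (2 * c)"
    by (rule extended_constant_approx[OF \<delta>]) blast
  have qt: "0 < q * t" and X_qt: "X < q * t" using X(2) q t by simp_all
  \<comment> \<open>Both factors are shrunk by \<open>s\<close>, the mean of 1 and \<theta>: it is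
    less than 1, yet its square is at least \<theta>, so the product stays at least
    \<open>X\<close>.\<close>
  define \<theta> where "\<theta> = X / (q * t)"
  define s where "s = (1 + \<theta>) / 2"
  have \<theta>: "0 \<le> \<theta>" "\<theta> < 1" "X = \<theta> * (q * t)"
    using qt X_qt X(1) q(2) t(2) by (simp_all add: \<theta>_def)
  have s: "0 < s" "s < 1" using \<theta> by (simp_all add: s_def)
  have "\<theta> \<le> s * s"
  proof -
    have "0 \<le> (1 - \<theta>)\<^sup>2" by simp
    then show ?thesis by (simp add: s_def power2_eq_square field_simps)
  qed
  then have "X \<le> (s * q) * (s * t)"
    using mult_right_mono[of \<theta> "s * s" "q * t"] qt by (simp add: \<theta>(3) mult_ac)
  moreover have "s * q < q" "s * t < t" using s q(2) t(2) by simp_all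
  from q'[OF this(1)] t'[OF this(2)]
  obtain c d where c: "0 < c" "ereal c \<le> \<beta>" "\<tau> < 2 * c" "s * q < 1 / \<tau> - 1 / (2 * c)"
    and d: "0 < d" "ereal d \<le> \<delta>" "\<gamma> < 2 * d" "s * t < 1 / \<gamma> - 1 / (2 * d)" by blast
  have "(s * q) * (s * t) < (1 / \<tau> - 1 / (2 * c)) * (1 / \<gamma> - 1 / (2 * d))"
  proof (intro mult_strict_mono c(4) d(4))
    have "0 < s * q" "0 < s * t" using s(1) q(2) t(2) by simp_all
    then show "0 < 1 / \<tau> - 1 / (2 * c)" "0 \<le> s * t" using c(4) by linarith+
  qed
  ultimately show thesis using that c(1-3) d(1-3) by fastforce
qed

theorem theorem3p3:
  fixes V :: "'h::{real_inner, complete_space} set"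
    and W :: "'g::{real_inner, complete_space} set"
    and T :: "'h \<Rightarrow> 'h" and L :: "'h \<Rightarrow> 'g"
    and A :: "'h \<Rightarrow> 'h set" and B D :: "'g \<Rightarrow> 'g set" and C :: "'h \<Rightarrow> 'h"
    and \<alpha> \<tau> \<gamma> :: real and \<beta> \<delta> :: ereal
    and x xbar y w r :: "nat \<Rightarrow> 'h" and u \<eta> :: "nat \<Rightarrow> 'g"
  assumes "subspace V" "closed V" and "subspace W" "closed W"
    and "0 < \<alpha>" "\<alpha> < 1" and "averaged_nonexpansive \<alpha> T"
    and "bounded_linear L" and "range L \<subseteq> W"
    and "maximally_monotone_op A" and "maximally_monotone_op B" and "maximally_monotone_op D"
    and "0 < \<beta>" and "cocoercive \<beta> C"
    and "0 < \<delta>" and "strongly_monotone_op \<delta> D"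
    and "solutions V W T L A B C D \<noteq> {}"
    and "0 < \<tau>" "ereal \<tau> < 2 * \<beta>" and "0 < \<gamma>" "ereal \<gamma> < 2 * \<delta>"
    and "ereal ((onorm L)\<^sup>2) < (1 / ereal \<tau> - 1 / (2 * \<beta>)) * (1 / ereal \<gamma> - 1 / (2 * \<delta>))"
    and "x 0 \<in> V" and "xbar 0 = x 0" and "y 0 \<in> V\<^sup>\<bottom>"
    and "\<And>k. \<eta> (Suc k) = op_value (resolvent (op_scale \<gamma> (op_inverse B)))
               (u k + \<gamma> *\<^sub>R (L (xbar k) - op_value (op_inverse D) (u k)))"
    and "\<And>k. u (Suc k) = ortho_proj W (\<eta> (Suc k))"
    and "\<And>k. w (Suc k) = op_value (resolvent (op_scale \<tau> A))
               (x k + \<tau> *\<^sub>R y k - \<tau> *\<^sub>R ortho_proj V (adjoint L (u (Suc k)) + C (x k)))"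
    and "\<And>k. r (Suc k) = ortho_proj V (w (Suc k))"
    and "\<And>k. x (Suc k) = ortho_proj V (T (r (Suc k)))"
    and "\<And>k. y (Suc k) = y k + (r (Suc k) - w (Suc k)) /\<^sub>R \<tau>"
    and "\<And>k. xbar (Suc k) = x (Suc k) + r (Suc k) - x k"
  shows "\<exists>xh uh. (xh, uh) \<in> solutions V W T L A B C D \<and>
           weakly_converges (\<lambda>k. (x k, u k)) (xh, uh)"
proof -
  define J where "J = op_value (op_inverse D)"
  define p where "p k = x k - xbar k" for k
  \<comment> \<open>The constants \<beta> and \<delta> do not occur in the recursion, so the given
    sequences also fit the locale with \<open>c\<close> and \<open>d\<close> in their place.\<close>
  obtain c d where c: "0 < c" "ereal c \<le> \<beta>" "\<tau> < 2 * c" and d: "0 < d" "ereal d \<le> \<delta>" "\<gamma> < 2 * d"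
    and small: "(onorm L)\<^sup>2 < (1 / \<tau> - 1 / (2 * c)) * (1 / \<gamma> - 1 / (2 * d))"
    by (rule finite_constants[OF \<open>0 < \<beta>\<close> \<open>0 < \<tau>\<close> \<open>ereal \<tau> < 2 * \<beta>\<close> \<open>0 < \<delta>\<close> \<open>0 < \<gamma>\<close>
        \<open>ereal \<gamma> < 2 * \<delta>\<close> zero_le_power2 assms(22)]) blast
  have D: "strongly_monotone_op (ereal d) D"
    by (rule strongly_monotone_op_antimono[OF \<open>strongly_monotone_op \<delta> D\<close> d(2)])
  have J_eq: "op_inverse D v = {J v}" for v
    unfolding J_def by (rule op_inverse_strongly_monotone[OF \<open>maximally_monotone_op D\<close> d(1) D])
  interpret projected_primal_dual V W T L A B C J \<alpha> c d \<tau> \<gamma> x p y w r u \<eta>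
  proof (rule projected_primal_dual.intro)
    show "cocoercive (ereal c) C" by (rule cocoercive_antimono[OF \<open>cocoercive \<beta> C\<close> c(2)])
    show "cocoercive (ereal d) J"
      unfolding J_def by (rule cocoercive_op_inverse[OF \<open>maximally_monotone_op D\<close> d(1) D])
    have xbar: "x k - p k = xbar k" for k by (simp add: p_def)
    show "(u k + \<gamma> *\<^sub>R (L (x k - p k) - J (u k)) - \<eta> (Suc k)) /\<^sub>R \<gamma> \<in> op_inverse B (\<eta> (Suc k))" for k
      unfolding xbar J_def
      by (rule op_value_resolvent_scale[OF maximally_monotone_op_inverse[OF \<open>maximally_monotone_op B\<close>] \<open>0 < \<gamma>\<close> assms(26)])
    show "(x k + \<tau> *\<^sub>R y k - \<tau> *\<^sub>R ortho_proj V (adjoint L (u (Suc k)) + C (x k)) - w (Suc k)) /\<^sub>R \<tau>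
        \<in> A (w (Suc k))" for k
      by (rule op_value_resolvent_scale[OF \<open>maximally_monotone_op A\<close> \<open>0 < \<tau>\<close> assms(28)])
    show "p 0 = 0" "p (Suc k) = x k - r (Suc k)" for k
      using assms(24,32) by (simp_all add: p_def)
  qed (rule assms c d small closed_subspace.intro)+
  note sol = solutions_eq[OF J_eq]
  have "kkt \<noteq> {}" using \<open>solutions V W T L A B C D \<noteq> {}\<close> unfolding sol by auto
  then obtain xh yh uh where h: "(xh, yh, uh) \<in> kkt" "weak_tendsto x xh sequentially"
    "weak_tendsto u uh sequentially"
    by (rule weak_convergence)
  have "weakly_converges (\<lambda>k. (x k, u k)) (xh, uh)"
    using h(2,3) by (intro weak_tendsto_weakly_converges) (simp add: weak_tendsto_Pair)
  then show ?thesis using h(1) unfolding sol by blast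
qed

end
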